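(* Let $F_d$ be the free group of rank $d$ with free basis $a_1,\dots,a_d$, acting on its Cayley tree $\mathcal T$ with respect to this basis. Let $\Gamma \leq F_d$ be a finitely generated subgroup, let $O \subset \mathrm{Sub}(F_d)$ be a neighborhood of $\Gamma$ in the Chabauty space, and let $\epsilon > 0$. Then there exists a boomerang subgroup $\Delta \in \mathrm{Sub}(F_d)$ with $\Delta \in O$ and $\delta(\Gamma) \leq \delta(\Delta) \leq \delta(\Gamma) + \epsilon$.
   Context: For a countable group $G$, $\mathrm{Sub}(G)$ is the set of subgroups of $G$ with the topology induced from the product topology via $\mathrm{Sub}(G) \subset \{0,1\}^G$ (the Chabauty space); $G$ acts on it by conjugation. A subgroup $\Delta \in \mathrm{Sub}(G)$ is a boomerang subgroup if for every $g \in G$ there is a sequence $n_k \to \infty$ with $\lim_{k\to\infty} g^{n_k}\Delta g^{-n_k} = \Delta$ in $\mathrm{Sub}(G)$. For $\Gamma \leq F_d$, $|g|$ denotes word length of $g\in F_d$ (the distance from $1$ to $g$ in $\mathcal T$), and the critical exponent is $\delta(\Gamma) = \inf\{ s>0 \mid \sum_{\gamma\in\Gamma} e^{-s|\gamma|} < \infty\}$; equivalently $\delta(\Gamma) = \lim_{R\to\infty} \frac{\ln c_\Gamma(R)}{R}$ where $c_\Gamma(R) = |\{\gamma\in\Gamma \mid |\gamma|\le R\}|$. *)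

theory Defs
  imports "HOL-Analysis.Analysis"
begin

text \<open>Letters of the free group: (i, False) is the basis element a_i, (i, True) is its inverse.
  Elements of F_d are freely reduced words over the letters with index < d.\<close>

type_synonym letter = "nat \<times> bool"
type_synonym word = "letter list"

definition linv :: "letter \<Rightarrow> letter" where
  "linv x = (fst x, \<not> snd x)"

fun reduced :: "word \<Rightarrow> bool" where
  "reduced [] = True"
| "reduced [x] = True"
| "reduced (x # y # ys) = (y \<noteq> linv x \<and> reduced (y # ys))"

definition FG :: "nat \<Rightarrow> word set" where
  "FG d = {w. reduced w \<and> (\<forall>x\<in>set w. fst x < d)}"

fun rcat :: "word \<Rightarrow> word \<Rightarrow> word" where
  "rcat [] ys = ys"
| "rcat (x # rx) [] = rev (x # rx)"
| "rcat (x # rx) (y # ys) = (if y = linv x then rcat rx ys else rev (x # rx) @ y # ys)"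

definition fmul :: "word \<Rightarrow> word \<Rightarrow> word" where
  "fmul u v = rcat (rev u) v"

definition finv :: "word \<Rightarrow> word" where
  "finv u = rev (map linv u)"

definition fpow :: "word \<Rightarrow> nat \<Rightarrow> word" where
  "fpow g n = (fmul g ^^ n) []"

text \<open>Word length |g| (= distance from 1 to g in the Cayley tree) is the length of the reduced word.\<close>
definition wlen :: "word \<Rightarrow> nat" where
  "wlen g = length g"

definition is_subgroup :: "nat \<Rightarrow> word set \<Rightarrow> bool" where
  "is_subgroup d H \<longleftrightarrow> H \<subseteq> FG d \<and> [] \<in> H \<and>
     (\<forall>g\<in>H. \<forall>h\<in>H. fmul g h \<in> H) \<and> (\<forall>g\<in>H. finv g \<in> H)"

definition gen_subgroup :: "nat \<Rightarrow> word set \<Rightarrow> word set" where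
  "gen_subgroup d S = \<Inter>{H. is_subgroup d H \<and> S \<subseteq> H}"

definition fin_gen :: "nat \<Rightarrow> word set \<Rightarrow> bool" where
  "fin_gen d H \<longleftrightarrow> (\<exists>S. finite S \<and> S \<subseteq> FG d \<and> H = gen_subgroup d S)"

definition conjg :: "word \<Rightarrow> word set \<Rightarrow> word set" where
  "conjg g H = (\<lambda>h. fmul (fmul g h) (finv g)) ` H"

text \<open>Chabauty space: a subgroup is identified with its indicator function in
  {0,1}^(words) = (word \<Rightarrow> bool), carrying the product topology (library instance).
  Since every subgroup lies inside FG d, this induces the topology from {0,1}^(F_d).\<close>
definition chab :: "word set \<Rightarrow> (word \<Rightarrow> bool)" where
  "chab H = (\<lambda>w. w \<in> H)"

definition chab_nbhd :: "nat \<Rightarrow> word set set \<Rightarrow> word set \<Rightarrow> bool" where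
  "chab_nbhd d Nb \<Gamma> \<longleftrightarrow> Nb \<subseteq> {H. is_subgroup d H} \<and>
     (\<exists>U. open U \<and> chab \<Gamma> \<in> U \<and> (\<forall>H. is_subgroup d H \<and> chab H \<in> U \<longrightarrow> H \<in> Nb))"

definition boomerang :: "nat \<Rightarrow> word set \<Rightarrow> bool" where
  "boomerang d \<Delta> \<longleftrightarrow> is_subgroup d \<Delta> \<and>
     (\<forall>g\<in>FG d. \<exists>n :: nat \<Rightarrow> nat. filterlim n at_top sequentially \<and>
        ((\<lambda>k. chab (conjg (fpow g (n k)) \<Delta>)) \<longlonglongrightarrow> chab \<Delta>))"

definition crit_exp :: "word set \<Rightarrow> real" where
  "crit_exp \<Gamma> = Inf {s. s > 0 \<and> (\<lambda>\<gamma>. exp (- s * real (wlen \<gamma>))) summable_on \<Gamma>}"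

end

theory Submission
  imports Defs
begin

text \<open>
  Enumerate the free group and enlarge \<open>\<Gamma>\<close> step by step, adjoining a very large power of the
  current element \<open>g\<close> unless the subgroup already contains a power of \<open>g\<close>. The union \<open>\<Delta>\<close> contains a
  positive power of every element, and \<open>\<Delta>\<close> is fixed under conjugation by its own elements, so it is
  a boomerang subgroup.

  To control \<open>\<Delta>\<close>, fix one exponent \<open>s\<close> between \<open>\<delta>(\<Gamma>)\<close> and \<open>\<delta>(\<Gamma>) + \<epsilon>\<close>. If no power of \<open>g\<close> lies in a
  finitely generated subgroup \<open>H\<close>, the axis of \<open>g\<close> leaves the convex hull of \<open>H\<close> in the Cayley tree in
  both directions and has bounded overlap with its translates by \<open>H\<close>. Hence cancellation in
  alternating products of elements of \<open>H\<close> and of \<open>t = g\<^sup>N\<close> is bounded independently of \<open>N\<close>, and the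
  Poincare series at \<open>s\<close> over the new elements of \<open>\<langle>H, t\<rangle>\<close> is dominated by a geometric series that
  tends to 0 as \<open>N\<close> grows. Making the total of all these contributions less than \<open>e\<^sup>-\<^sup>s\<^sup>R\<close> gives
  \<open>\<delta>(\<Delta>) \<le> s\<close> and at the same time rules out new elements of length at most \<open>R\<close>.
\<close>

section \<open>Free reduction\<close>

lemma linv_linv [simp]: "linv (linv x) = x"
  by (simp add: linv_def)

lemma linv_neq [simp]: "linv x \<noteq> x" "x \<noteq> linv x"
  by (auto simp: linv_def prod_eq_iff)

lemma linv_eq_iff [simp]: "linv x = linv y \<longleftrightarrow> x = y"
  by (metis linv_linv)

lemma fst_linv [simp]: "fst (linv x) = fst x"
  by (simp add: linv_def)

lemma finv_Nil [simp]: "finv [] = []"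
  by (simp add: finv_def)

lemma finv_append [simp]: "finv (u @ v) = finv v @ finv u"
  by (simp add: finv_def)

lemma finv_Cons: "finv (x # u) = finv u @ [linv x]"
  by (simp add: finv_def)

lemma finv_finv [simp]: "finv (finv u) = u"
  by (simp add: finv_def rev_map comp_def)

lemma length_finv [simp]: "length (finv u) = length u"
  by (simp add: finv_def)

lemma finv_eq_Nil [simp]: "finv u = [] \<longleftrightarrow> u = []"
  by (simp add: finv_def)

lemma finv_eq_iff: "finv u = v \<longleftrightarrow> u = finv v"
  by auto

lemma set_finv: "set (finv u) = linv ` set u"
  by (simp add: finv_def)

lemma hd_finv: "u \<noteq> [] \<Longrightarrow> hd (finv u) = linv (last u)"
  by (simp add: finv_def hd_rev last_map)

lemma last_finv: "u \<noteq> [] \<Longrightarrow> last (finv u) = linv (hd u)"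
  by (metis finv_eq_Nil finv_finv hd_finv linv_linv)

lemma reduced_Cons:
  "reduced (x # u) \<longleftrightarrow> reduced u \<and> (u \<noteq> [] \<longrightarrow> hd u \<noteq> linv x)"
  by (cases u) auto

lemma reduced_append:
  "reduced (u @ v) \<longleftrightarrow>
     reduced u \<and> reduced v \<and> (u \<noteq> [] \<longrightarrow> v \<noteq> [] \<longrightarrow> hd v \<noteq> linv (last u))"
  by (induction u) (auto simp: reduced_Cons hd_append)

lemma reduced_finv [simp]: "reduced (finv u) \<longleftrightarrow> reduced u"
proof -
  have "reduced u \<Longrightarrow> reduced (finv u)" for u
    by (induction u) (auto simp: reduced_Cons finv_Cons reduced_append last_finv)
  from this[of u] this[of "finv u"] show ?thesis by auto
qed

section \<open>Normal forms of words under free reduction\<close>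

fun lcons :: "letter \<Rightarrow> word \<Rightarrow> word" where
  "lcons x [] = [x]"
| "lcons x (y # ys) = (if y = linv x then ys else x # y # ys)"

text \<open>Van der Waerden's device: each letter acts on reduced words by \<open>lcons\<close>, and
  \<open>nf w\<close> is the image of the empty word under \<open>w\<close>. Group identities become
  equalities between \<open>nf\<close> of concatenations, with associativity for free.\<close>

definition nf :: "word \<Rightarrow> word" where
  "nf w = foldr lcons w []"

lemma reduced_lcons: "reduced w \<Longrightarrow> reduced (lcons x w)"
  by (cases w) (auto simp: reduced_Cons)

lemma reduced_foldr_lcons: "reduced w \<Longrightarrow> reduced (foldr lcons u w)"
  by (induction u) (auto simp: reduced_lcons)

lemma reduced_nf [simp]: "reduced (nf w)"
  by (simp add: nf_def reduced_foldr_lcons)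

text \<open>Letters act invertibly on reduced words: once a leading \<open>x\<close> is deleted, the
  next letter cannot be \<open>linv x\<close>, so \<open>x\<close> returns in front.\<close>

lemma lcons_lcons_linv: "reduced w \<Longrightarrow> lcons x (lcons (linv x) w) = w"
proof (cases w)
  case (Cons y w')
  assume "reduced w"
  with Cons show ?thesis by (cases w') auto
qed simp

lemma foldr_lcons_lcons:
  assumes "reduced r"
  shows "foldr lcons (lcons x w) r = lcons x (foldr lcons w r)"
  by (cases w) (auto simp: lcons_lcons_linv reduced_foldr_lcons assms)

lemma foldr_lcons_nf: "reduced r \<Longrightarrow> foldr lcons (nf u) r = foldr lcons u r"
  by (induction u) (auto simp: nf_def foldr_lcons_lcons)

lemma nf_append_foldr: "nf (u @ v) = foldr lcons u (nf v)"
  by (simp add: nf_def)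

lemma nf_reduced: "reduced w \<Longrightarrow> nf w = w"
proof (induction w)
  case (Cons x w)
  then show ?case
    by (cases w) (auto simp: nf_def)
qed (simp add: nf_def)

lemma nf_Nil [simp]: "nf [] = []"
  by (simp add: nf_def)

lemma nf_nf [simp]: "nf (nf w) = nf w"
  by (simp add: nf_reduced)

lemma nf_nf_append [simp]: "nf (nf u @ v) = nf (u @ v)"
  by (simp add: nf_append_foldr foldr_lcons_nf)

lemma nf_append_nf [simp]: "nf (u @ nf v) = nf (u @ v)"
  by (simp add: nf_append_foldr)

lemma nf_append_nf_append [simp]: "nf (u @ nf v @ w) = nf (u @ v @ w)"
  by (metis nf_append_nf nf_nf_append)

lemma nf_append_cong: "nf u = nf u' \<Longrightarrow> nf v = nf v' \<Longrightarrow> nf (u @ v) = nf (u' @ v')"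
  by (metis nf_append_nf nf_nf_append)

lemma foldr_lcons_finv: "reduced r \<Longrightarrow> foldr lcons u (foldr lcons (finv u) r) = r"
  by (induction u arbitrary: r)
    (auto simp: finv_Cons lcons_lcons_linv reduced_lcons)

lemma nf_inv_right [simp]: "nf (u @ finv u @ v) = nf v"
  by (simp add: nf_append_foldr foldr_lcons_finv)

lemma nf_inv_left [simp]: "nf (finv u @ u @ v) = nf v"
  using nf_inv_right[of "finv u" v] by simp

lemma nf_inv_right_mid [simp]: "nf (w @ u @ finv u @ v) = nf (w @ v)"
  by (metis nf_append_nf nf_inv_right)

lemma nf_inv_left_mid [simp]: "nf (w @ finv u @ u @ v) = nf (w @ v)"
  using nf_inv_right_mid[of w "finv u" v] by simp

lemma nf_inv_right_end [simp]: "nf (u @ finv u) = []" "nf (w @ u @ finv u) = nf w"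
  using nf_inv_right[of u "[]"] nf_inv_right_mid[of w u "[]"] by simp_all

lemma nf_inv_left_end [simp]: "nf (finv u @ u) = []" "nf (w @ finv u @ u) = nf w"
  using nf_inv_left[of u "[]"] nf_inv_left_mid[of w u "[]"] by simp_all

lemma nf_cancel_left: "nf (u @ v) = nf (u @ w) \<Longrightarrow> nf v = nf w"
  by (metis nf_append_nf nf_inv_left)

lemma nf_cancel_right: "nf (v @ u) = nf (w @ u) \<Longrightarrow> nf v = nf w"
  by (metis append.assoc nf_inv_right_end(2) nf_nf_append)

lemma nf_finv: "nf (finv u) = finv (nf u)"
proof -
  have "nf (nf u @ finv (nf u)) = nf (nf u @ finv u)"
    by simp
  then have "nf (finv (nf u)) = nf (finv u)"
    by (rule nf_cancel_left)
  then show ?thesis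
    by (simp add: nf_reduced)
qed

lemma length_nf_le: "length (nf w) \<le> length w"
proof (induction w)
  case (Cons x w)
  have "length (lcons x u) \<le> Suc (length u)" for u
    by (cases u) auto
  with Cons show ?case
    by (metis (no_types, lifting) foldr.simps(2) comp_apply le_trans length_Cons nf_def not_less_eq_eq)
qed simp

lemma set_nf_subset: "set (nf w) \<subseteq> set w"
proof (induction w)
  case (Cons x w)
  have "set (lcons x u) \<subseteq> insert x (set u)" for u
    by (cases u) auto
  with Cons show ?case
    by (fastforce simp: nf_def)
qed simp

text \<open>\<open>rcat\<close> consumes the first factor from its end, hence the induction over the
  reversed list. From here on products are handled as \<open>nf\<close> of concatenations.\<close>

lemma fmul_nf:
  assumes "reduced u" "reduced v"
  shows "fmul u v = nf (u @ v)"
proof -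
  have "rcat ru v = nf (rev ru @ v)" if "reduced (rev ru)" "reduced v" for ru v
    using that
  proof (induction ru v rule: rcat.induct)
    case (3 x rx y ys)
    show ?case
    proof (cases "y = linv x")
      case True
      have "nf (rev rx @ [x] @ finv [x] @ ys) = nf (rev rx @ ys)"
        by (rule nf_inv_right_mid)
      with True 3 show ?thesis
        by (simp add: reduced_append reduced_Cons finv_Cons)
    next
      case False
      with 3 show ?thesis
        by (simp add: nf_reduced reduced_append reduced_Cons)
    qed
  qed (auto simp: nf_reduced)
  from this[of "rev u" v] assms show ?thesis
    by (simp add: fmul_def)
qed

text \<open>The basic cancellation tool: cancellation proceeds outwards from the seam, so it removes
  a suffix \<open>r\<close> of \<open>u\<close> together with its inverse at the start of
  \<open>v\<close>.\<close>

lemma nf_append_split: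
  assumes "reduced u" "reduced v"
  obtains a r b where "u = a @ r" "v = finv r @ b" "nf (u @ v) = a @ b"
proof -
  have "\<exists>a r b. u = a @ r \<and> v = finv r @ b \<and> nf (u @ v) = a @ b"
    using assms
  proof (induction u arbitrary: v rule: rev_induct)
    case (snoc x u)
    show ?case
    proof (cases "v \<noteq> [] \<and> hd v = linv x")
      case True
      then obtain w where v: "v = linv x # w"
        by (cases v) auto
      with snoc obtain a r b where "u = a @ r" "w = finv r @ b" "nf (u @ w) = a @ b"
        by (metis reduced_append reduced_Cons)
      moreover have "nf (u @ [x] @ finv [x] @ w) = nf (u @ w)"
        by (rule nf_inv_right_mid)
      ultimately show ?thesis
        by (intro exI[of _ a] exI[of _ "r @ [x]"] exI[of _ b]) (simp add: v finv_Cons)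
    next
      case False
      with snoc.prems have "reduced ((u @ [x]) @ v)"
        by (auto simp: reduced_append reduced_Cons)
      then show ?thesis
        by (intro exI[of _ "u @ [x]"] exI[of _ "[]"] exI[of _ v]) (simp add: nf_reduced)
    qed
  qed (simp add: nf_reduced)
  with that show ?thesis by blast
qed

section \<open>Powers and cyclic reduction\<close>

definition wpow :: "word \<Rightarrow> nat \<Rightarrow> word" where
  "wpow u n = concat (replicate n u)"

lemma wpow_0 [simp]: "wpow u 0 = []"
  by (simp add: wpow_def)

lemma wpow_Suc: "wpow u (Suc n) = u @ wpow u n"
  by (simp add: wpow_def)

lemma wpow_add: "wpow u (m + n) = wpow u m @ wpow u n"
  by (simp add: wpow_def replicate_add)

lemma wpow_Suc2: "wpow u (Suc n) = wpow u n @ u"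
  using wpow_add[of u n 1] by (simp add: wpow_Suc)

lemma finv_wpow: "finv (wpow u n) = wpow (finv u) n"
  by (induction n) (simp_all add: wpow_Suc2[of u] wpow_Suc[of "finv u"])

lemma length_wpow [simp]: "length (wpow u n) = n * length u"
  by (induction n) (simp_all add: wpow_Suc)

lemma wpow_eq_Nil [simp]: "wpow u n = [] \<longleftrightarrow> n = 0 \<or> u = []"
  by (simp flip: length_0_conv)

lemma set_wpow: "set (wpow u n) \<subseteq> set u"
  by (auto simp: wpow_def)

lemma last_wpow: "u \<noteq> [] \<Longrightarrow> n > 0 \<Longrightarrow> last (wpow u n) = last u"
  by (cases n) (simp_all add: wpow_Suc2)

lemma hd_wpow: "u \<noteq> [] \<Longrightarrow> n > 0 \<Longrightarrow> hd (wpow u n) = hd u"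
  by (cases n) (simp_all add: wpow_Suc)

lemma nf_wpow_nf: "nf (wpow (nf u) n) = nf (wpow u n)"
  by (induction n) (simp_all add: wpow_Suc, metis nf_append_nf)

lemma nf_wpow_conj: "nf (wpow (x @ c @ finv x) n) = nf (x @ wpow c n @ finv x)"
proof (induction n)
  case (Suc n)
  have "nf (wpow (x @ c @ finv x) (Suc n)) = nf ((x @ c @ finv x) @ nf (wpow (x @ c @ finv x) n))"
    by (simp only: wpow_Suc nf_append_nf)
  also have "\<dots> = nf ((x @ c) @ finv x @ x @ wpow c n @ finv x)"
    unfolding Suc nf_append_nf by simp
  finally show ?case
    by (simp only: nf_inv_left_mid) (simp add: wpow_Suc)
qed simp

lemma reduced_wpow: "reduced (c @ c) \<Longrightarrow> reduced (wpow c n)"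
  by (induction n) (auto simp: wpow_Suc reduced_append hd_wpow split: if_splits)

text \<open>Peel off mutually inverse outer letters. In the tree, \<open>x\<close> leads from 1 to
  the axis of \<open>g\<close> and \<open>c\<close> labels one period of the axis;
  \<open>reduced (c @ c)\<close> says that periods join without cancellation.\<close>

lemma cyclic_reduction:
  assumes "reduced g" "g \<noteq> []"
  obtains x c where "g = x @ c @ finv x" "c \<noteq> []" "reduced (c @ c)"
proof -
  have "\<exists>x c. g = x @ c @ finv x \<and> c \<noteq> [] \<and> reduced (c @ c)"
    using assms
  proof (induction "length g" arbitrary: g rule: less_induct)
    case less
    show ?case
    proof (cases "hd g = linv (last g)")
      case False
      with less.prems show ?thesis
        by (intro exI[of _ "[]"] exI[of _ g]) (simp add: reduced_append)
    next
      case True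
      obtain y h where g: "g = y # h" using less.prems by (cases g) auto
      with True have "h \<noteq> []" by auto
      then obtain k z where h: "h = k @ [z]" by (metis rev_exhaust)
      with True g have yz: "z = linv y" by simp
      have "k \<noteq> []"
        using less.prems by (auto simp: g h yz)
      moreover have "reduced k"
        using less.prems by (auto simp: g h reduced_Cons reduced_append)
      ultimately obtain x c where "k = x @ c @ finv x" "c \<noteq> []" "reduced (c @ c)"
        using less.hyps[of k] by (auto simp: g h)
      then show ?thesis
        by (intro exI[of _ "y # x"] exI[of _ c]) (simp add: g h yz finv_Cons)
    qed
  qed
  with that show ?thesis by blast
qed

lemma reduced_conj_wpow:
  assumes "reduced (x @ c @ finv x)" "c \<noteq> []" "reduced (c @ c)"
  shows "reduced (x @ wpow c n)" "n > 0 \<Longrightarrow> reduced (x @ wpow c n @ finv x)"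
  using assms reduced_wpow[OF assms(3), of n]
  by (cases "n = 0"; auto simp: reduced_append hd_wpow last_wpow hd_append)+

text \<open>Only the cyclically reduced core is repeated in the reduced form of a power, and it has
  at least one letter. This is a quantitative form of torsion-freeness.\<close>

lemma length_nf_wpow_ge:
  assumes "nf g \<noteq> []"
  shows "length (nf (wpow g n)) \<ge> n"
proof (cases "n = 0")
  case False
  obtain x c where xc: "nf g = x @ c @ finv x" "c \<noteq> []" "reduced (c @ c)"
    using cyclic_reduction[of "nf g"] assms by auto
  have "nf (wpow g n) = nf (wpow (nf g) n)"
    by (simp add: nf_wpow_nf)
  also have "\<dots> = nf (x @ wpow c n @ finv x)"
    by (simp add: xc nf_wpow_conj)
  also have "\<dots> = x @ wpow c n @ finv x"
    using reduced_conj_wpow(2)[of x c n] xc False reduced_nf[of g] by (intro nf_reduced) auto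
  finally have "length (nf (wpow g n)) \<ge> n * length c"
    by simp
  moreover have "n * length c \<ge> n * 1"
    using xc by (intro mult_le_mono) (auto simp: Suc_le_eq)
  ultimately show ?thesis by linarith
qed simp

section \<open>Subgroups\<close>

lemma FG_iff: "w \<in> FG d \<longleftrightarrow> reduced w \<and> (\<forall>x\<in>set w. fst x < d)"
  by (simp add: FG_def)

lemma nf_in_FG: "(\<forall>x\<in>set w. fst x < d) \<Longrightarrow> nf w \<in> FG d"
  using set_nf_subset[of w] by (auto simp: FG_iff)

lemma FG_finv: "w \<in> FG d \<Longrightarrow> finv w \<in> FG d"
  by (auto simp: FG_iff set_finv)

lemma is_subgroup_iff:
  "is_subgroup d H \<longleftrightarrow> H \<subseteq> FG d \<and> [] \<in> H \<and>
     (\<forall>g\<in>H. \<forall>h\<in>H. nf (g @ h) \<in> H) \<and> (\<forall>g\<in>H. finv g \<in> H)"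
proof (cases "H \<subseteq> FG d")
  case True
  then have "fmul g h = nf (g @ h)" if "g \<in> H" "h \<in> H" for g h
    using that by (intro fmul_nf) (auto simp: FG_iff)
  then show ?thesis
    unfolding is_subgroup_def by auto
qed (simp add: is_subgroup_def)

lemma
  assumes "is_subgroup d H"
  shows subgroup_FG: "h \<in> H \<Longrightarrow> h \<in> FG d"
    and subgroup_reduced: "h \<in> H \<Longrightarrow> reduced h"
    and subgroup_Nil: "[] \<in> H"
    and subgroup_mult: "g \<in> H \<Longrightarrow> h \<in> H \<Longrightarrow> nf (g @ h) \<in> H"
    and subgroup_finv: "g \<in> H \<Longrightarrow> finv g \<in> H"
  using assms unfolding is_subgroup_iff by (blast, metis FG_iff subsetD, blast+)

lemma subgroup_wpow: "is_subgroup d H \<Longrightarrow> nf g \<in> H \<Longrightarrow> nf (wpow g n) \<in> H"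
proof (induction n)
  case (Suc n)
  then have "nf (nf g @ nf (wpow g n)) \<in> H"
    by (intro subgroup_mult) auto
  then show ?case by (simp add: wpow_Suc)
qed (simp add: subgroup_Nil)

lemma fpow_eq_nf_wpow:
  assumes "reduced g"
  shows "fpow g n = nf (wpow g n)"
  by (induction n) (simp_all add: fpow_def wpow_Suc fmul_nf assms)

lemma gen_subgroup_superset: "S \<subseteq> gen_subgroup d S"
  by (auto simp: gen_subgroup_def)

lemma is_subgroup_FG: "is_subgroup d (FG d)"
  unfolding is_subgroup_iff
proof (intro conjI ballI)
  show "nf (g @ h) \<in> FG d" if "g \<in> FG d" "h \<in> FG d" for g h
    using that by (intro nf_in_FG) (auto simp only: FG_iff set_append)
qed (auto simp: FG_finv, simp add: FG_iff)

lemma is_subgroup_gen_subgroup: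
  assumes "S \<subseteq> FG d"
  shows "is_subgroup d (gen_subgroup d S)"
proof -
  have "gen_subgroup d S \<subseteq> FG d"
    using assms is_subgroup_FG by (auto simp: gen_subgroup_def)
  then show ?thesis
    by (auto simp: is_subgroup_iff gen_subgroup_def)
qed

lemma gen_subgroup_mono: "S \<subseteq> S' \<Longrightarrow> gen_subgroup d S \<subseteq> gen_subgroup d S'"
  by (auto simp: gen_subgroup_def)

lemma gen_subgroup_eq:
  assumes "S \<subseteq> FG d" "\<gamma> \<in> gen_subgroup d S"
  obtains ss where "set ss \<subseteq> S \<union> finv ` S" "\<gamma> = nf (concat ss)"
proof -
  let ?H = "{nf (concat ss) |ss. set ss \<subseteq> S \<union> finv ` S}"
  have "is_subgroup d ?H"
    unfolding is_subgroup_iff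
  proof (intro conjI ballI subsetI)
    fix w assume "w \<in> ?H"
    then obtain ss where ss: "w = nf (concat ss)" "set ss \<subseteq> S \<union> finv ` S"
      by auto
    have "u \<in> FG d" if "u \<in> set ss" for u
      using that ss(2) assms(1) FG_finv by blast
    then have "\<forall>y\<in>set (concat ss). fst y < d"
      by (simp add: FG_iff)
    then show "w \<in> FG d"
      using ss(1) nf_in_FG by blast
  next
    show "[] \<in> ?H"
      by (intro CollectI exI[of _ "[]"]) simp
  next
    fix g h assume "g \<in> ?H" "h \<in> ?H"
    then obtain ss tt where "g = nf (concat ss)" "set ss \<subseteq> S \<union> finv ` S"
      "h = nf (concat tt)" "set tt \<subseteq> S \<union> finv ` S"
      by auto
    then show "nf (g @ h) \<in> ?H"
      by (intro CollectI exI[of _ "ss @ tt"]) auto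
  next
    fix g assume "g \<in> ?H"
    then obtain ss where ss: "g = nf (concat ss)" "set ss \<subseteq> S \<union> finv ` S"
      by auto
    have "finv (concat ss) = concat (rev (map finv ss))"
      by (induction ss) auto
    then have "finv g = nf (concat (rev (map finv ss)))"
      by (simp add: ss(1) flip: nf_finv)
    moreover have "set (rev (map finv ss)) \<subseteq> S \<union> finv ` S"
      using ss(2) by auto
    ultimately show "finv g \<in> ?H" by blast
  qed
  moreover have "S \<subseteq> ?H"
  proof
    fix s assume "s \<in> S"
    with assms(1) show "s \<in> ?H"
      by (intro CollectI exI[of _ "[s]"]) (auto simp: nf_reduced FG_iff)
  qed
  ultimately have "gen_subgroup d S \<subseteq> ?H"
    by (auto simp: gen_subgroup_def)
  with assms(2) that show ?thesis by auto
qed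

lemma gen_subgroup_left_induct [consumes 2, case_names Nil mult]:
  assumes "S \<subseteq> FG d" "\<gamma> \<in> gen_subgroup d S"
    and "P []" and "\<And>s w. s \<in> S \<union> finv ` S \<Longrightarrow> P w \<Longrightarrow> P (nf (s @ w))"
  shows "P \<gamma>"
proof -
  obtain ss where "set ss \<subseteq> S \<union> finv ` S" and \<gamma>: "\<gamma> = nf (concat ss)"
    using gen_subgroup_eq[OF assms(1,2)] .
  have "P (nf (concat ss))"
    using \<open>set ss \<subseteq> S \<union> finv ` S\<close>
  proof (induction ss)
    case (Cons s ss)
    then have "P (nf (s @ nf (concat ss)))"
      by (intro assms(4)) auto
    then show ?case by simp
  qed (simp add: assms(3))
  with \<gamma> show ?thesis by simp
qed

text \<open>Finitely generated subgroups are quasiconvex: the geodesic from 1 to a subgroup element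
  stays close to the subgroup. A prefix of the reduced product of \<open>s\<close> and
  \<open>w\<close> either lies in the short word \<open>s\<close> or is moved by
  \<open>finv s\<close> onto a prefix of \<open>w\<close>.\<close>

lemma gen_subgroup_quasiconvex:
  assumes "finite S" "S \<subseteq> FG d"
  obtains C where
    "\<And>p q. p @ q \<in> gen_subgroup d S \<Longrightarrow> \<exists>h\<in>gen_subgroup d S. length (nf (h @ p)) \<le> C"
proof -
  let ?G = "gen_subgroup d S"
  define C where "C = Max (insert 0 (length ` S))"
  have C: "length s \<le> C" if "s \<in> S \<union> finv ` S" for s
    using that assms(1) by (auto simp: C_def intro!: Max_ge)
  note G = is_subgroup_gen_subgroup[OF assms(2)]
  have SG: "s \<in> ?G" if "s \<in> S \<union> finv ` S" for s
    using that gen_subgroup_superset[of S d] subgroup_finv[OF G] by auto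
  have "reduced \<gamma> \<and> (\<forall>p q. \<gamma> = p @ q \<longrightarrow> (\<exists>h\<in>?G. length (nf (h @ p)) \<le> C))" if "\<gamma> \<in> ?G" for \<gamma>
    using assms(2) that
  proof (induction rule: gen_subgroup_left_induct)
    case Nil
    show ?case using subgroup_Nil[OF G] by (auto intro!: bexI[of _ "[]"])
  next
    case (mult s w)
    have "\<exists>h\<in>?G. length (nf (h @ p)) \<le> C" if pq: "nf (s @ w) = p @ q" for p q
    proof -
      obtain a r b where ab: "s = a @ r" "w = finv r @ b" "nf (s @ w) = a @ b"
        using nf_append_split[OF subgroup_reduced[OF G SG[OF mult(1)]] conjunct1[OF mult(2)]] .
      from pq ab(3) have "p @ q = a @ b" by simp
      then consider r' where "a = p @ r'" | b' where "p = a @ b'" "b = b' @ q"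
        by (auto simp: append_eq_append_conv2)
      then show ?thesis
      proof cases
        case 1
        have "length p \<le> C"
          using C[OF mult(1)] by (simp add: ab(1) 1)
        then have "length (nf ([] @ p)) \<le> C"
          using length_nf_le[of p] by simp
        then show ?thesis
          using subgroup_Nil[OF G] by blast
      next
        case 2
        have "w = (finv r @ b') @ q"
            by (simp add: ab(2) 2)
          then obtain h where h: "h \<in> ?G" "length (nf (h @ finv r @ b')) \<le> C"
            using mult(2) by blast
        have "nf (nf (h @ finv s) @ p) = nf ((h @ finv r) @ finv a @ a @ b')"
          by (simp add: ab 2)
        also have "\<dots> = nf (h @ finv r @ b')"
          by (simp only: nf_inv_left_mid) simp
        finally have "length (nf (nf (h @ finv s) @ p)) \<le> C"
          using h(2) by simp
        moreover have "nf (h @ finv s) \<in> ?G"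
          using h(1) SG[OF mult(1)] by (intro subgroup_mult[OF G] subgroup_finv[OF G])
        ultimately show ?thesis by blast
      qed
    qed
    then show ?case by simp
  qed
  then show ?thesis using that by blast
qed

section \<open>Exponential sums\<close>

text \<open>The Poincare series of \<open>A\<close> at \<open>s\<close> is at most \<open>b\<close>,
  phrased by finite partial sums so that unions and products can be estimated before convergence is
  known.\<close>

definition wbound :: "real \<Rightarrow> word set \<Rightarrow> real \<Rightarrow> bool" where
  "wbound s A b \<longleftrightarrow> (\<forall>F. finite F \<longrightarrow> F \<subseteq> A \<longrightarrow> (\<Sum>w\<in>F. exp (- s * real (length w))) \<le> b)"

lemma wboundI:
  "(\<And>F. finite F \<Longrightarrow> F \<subseteq> A \<Longrightarrow> (\<Sum>w\<in>F. exp (- s * real (length w))) \<le> b) \<Longrightarrow> wbound s A b"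
  by (simp add: wbound_def)

lemma wboundD:
  "wbound s A b \<Longrightarrow> finite F \<Longrightarrow> F \<subseteq> A \<Longrightarrow> (\<Sum>w\<in>F. exp (- s * real (length w))) \<le> b"
  by (simp add: wbound_def)

lemma wbound_nonneg: "wbound s A b \<Longrightarrow> b \<ge> 0"
  using wboundD[of s A b "{}"] by simp

lemma wbound_mono: "wbound s A b \<Longrightarrow> B \<subseteq> A \<Longrightarrow> b \<le> c \<Longrightarrow> wbound s B c"
  unfolding wbound_def by (meson order_trans)

lemma wbound_elem: "wbound s A b \<Longrightarrow> w \<in> A \<Longrightarrow> exp (- s * real (length w)) \<le> b"
  using wboundD[of s A b "{w}"] by simp

lemma wbound_singleton: "wbound s {w} (exp (- s * real (length w)))"
  by (rule wboundI) (auto simp: subset_singleton_iff)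

lemma wbound_Un:
  assumes "wbound s A a" "wbound s B b"
  shows "wbound s (A \<union> B) (a + b)"
proof (rule wboundI)
  fix F assume F: "finite F" "F \<subseteq> A \<union> B"
  let ?f = "\<lambda>w :: word. exp (- s * real (length w))"
  have "sum ?f F = sum ?f (F \<inter> A) + sum ?f (F - A)"
    using F(1) by (rule sum.Int_Diff)
  also have "\<dots> \<le> a + b"
    using F assms by (intro add_mono wboundD) auto
  finally show "sum ?f F \<le> a + b" .
qed

lemma wbound_UN_lessThan:
  fixes A :: "nat \<Rightarrow> word set"
  assumes "\<And>m. wbound s (A m) (a m)"
  shows "wbound s (\<Union>m<n. A m) (\<Sum>m<n. a m)"
proof (induction n)
  case 0
  then show ?case by (auto intro: wboundI)
next
  case (Suc n)
  from wbound_Un[OF this assms[of n]] show ?case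
    by (simp add: lessThan_Suc Un_commute add.commute)
qed

lemma wbound_UN:
  fixes A :: "nat \<Rightarrow> word set"
  assumes "\<And>m. wbound s (A m) (a m)" and "\<And>n. (\<Sum>m<n. a m) \<le> b"
  shows "wbound s (\<Union>m. A m) b"
proof (rule wboundI)
  fix F assume F: "finite F" "F \<subseteq> (\<Union>m. A m)"
  then have "\<forall>w\<in>F. \<exists>m. w \<in> A m" by auto
  then obtain k where k: "\<And>w. w \<in> F \<Longrightarrow> w \<in> A (k w)" by metis
  have "F \<subseteq> (\<Union>m<Suc (Max (insert 0 (k ` F))). A m)"
  proof
    fix w assume w: "w \<in> F"
    then have "k w \<le> Max (insert 0 (k ` F))"
      using F(1) by (intro Max_ge) auto
    then show "w \<in> (\<Union>m<Suc (Max (insert 0 (k ` F))). A m)"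
      using k[OF w] by (auto simp: less_Suc_eq_le)
  qed
  then have "(\<Sum>w\<in>F. exp (- s * real (length w))) \<le> (\<Sum>m<Suc (Max (insert 0 (k ` F))). a m)"
    using F(1) wbound_UN_lessThan[OF assms(1)] by (intro wboundD)
  also have "\<dots> \<le> b" by (rule assms(2))
  finally show "(\<Sum>w\<in>F. exp (- s * real (length w))) \<le> b" .
qed

text \<open>Words identified by \<open>f\<close> are counted once in the image, so summing over
  preimages can only overestimate.\<close>

lemma wbound_image:
  assumes "wbound s A a" "K \<ge> 0"
    and "\<And>w. w \<in> A \<Longrightarrow> exp (- s * real (length (f w))) \<le> K * exp (- s * real (length w))"
  shows "wbound s (f ` A) (K * a)"
proof (rule wboundI)
  let ?f = "\<lambda>w :: word. exp (- s * real (length w))"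
  fix F assume F: "finite F" "F \<subseteq> f ` A"
  then obtain B where B: "B \<subseteq> A" "finite B" "F = f ` B"
    by (meson finite_subset_image)
  have "(\<Sum>w\<in>F. exp (- s * real (length w))) \<le> (\<Sum>w\<in>B. exp (- s * real (length (f w))))"
    unfolding B(3) by (rule sum_image_le[where g = ?f, unfolded comp_def]) (use B in auto)
  also have "\<dots> \<le> (\<Sum>w\<in>B. K * exp (- s * real (length w)))"
    using B assms(3) by (intro sum_mono) auto
  also have "\<dots> = K * (\<Sum>w\<in>B. exp (- s * real (length w)))"
    by (simp add: sum_distrib_left)
  also have "\<dots> \<le> K * a"
    using assms B by (intro mult_left_mono wboundD) auto
  finally show "(\<Sum>w\<in>F. exp (- s * real (length w))) \<le> K * a" .
qed

text \<open>Weights multiply under concatenation, so the product of the two sums dominates;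
  different pairs with the same concatenation only lower the left side.\<close>

lemma wbound_append:
  assumes "wbound s A a" "wbound s B b"
  shows "wbound s {u @ v |u v. u \<in> A \<and> v \<in> B} (a * b)"
proof (rule wboundI)
  let ?f = "\<lambda>w :: word. exp (- s * real (length w))"
  fix F assume F: "finite F" "F \<subseteq> {u @ v |u v. u \<in> A \<and> v \<in> B}"
  then have "F \<subseteq> (\<lambda>(u, v). u @ v) ` (A \<times> B)" by auto
  then obtain C where C: "C \<subseteq> A \<times> B" "finite C" "F = (\<lambda>(u, v). u @ v) ` C"
    using F(1) by (meson finite_subset_image)
  have "sum ?f F \<le> (\<Sum>p\<in>C. ?f (case p of (u, v) \<Rightarrow> u @ v))"
    unfolding C(3) by (rule sum_image_le[where g = ?f, unfolded comp_def]) (use C in auto)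
  also have "\<dots> = (\<Sum>(u, v)\<in>C. ?f u * ?f v)"
    by (intro sum.cong) (auto simp: algebra_simps simp flip: exp_add)
  also have "\<dots> \<le> (\<Sum>(u, v)\<in>fst ` C \<times> snd ` C. ?f u * ?f v)"
    using C by (intro sum_mono2) (auto intro: rev_image_eqI)
  also have "\<dots> = sum ?f (fst ` C) * sum ?f (snd ` C)"
    by (simp add: sum_product sum.cartesian_product)
  also have "\<dots> \<le> a * b"
    using C assms wbound_nonneg by (intro mult_mono wboundD sum_nonneg) auto
  finally show "sum ?f F \<le> a * b" .
qed

lemma wbound_imp_summable_on:
  assumes "wbound s A b"
  shows "(\<lambda>w. exp (- s * real (wlen w))) summable_on A"
  using assms unfolding wbound_def
  by (intro nonneg_bdd_above_summable_on bdd_aboveI[of _ b]) (auto simp: wlen_def)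

lemma summable_on_imp_wbound:
  assumes "(\<lambda>w. exp (- s * real (wlen w))) summable_on A"
  obtains b where "wbound s A b"
proof
  show "wbound s A (\<Sum>\<^sub>\<infinity>w\<in>A. exp (- s * real (wlen w)))"
  proof (rule wboundI)
    fix F assume "finite F" "F \<subseteq> A"
    then show "(\<Sum>w\<in>F. exp (- s * real (length w))) \<le> (\<Sum>\<^sub>\<infinity>w\<in>A. exp (- s * real (wlen w)))"
      using finite_sum_le_infsum[OF assms, of F] by (simp add: wlen_def)
  qed
qed

lemma geometric_partial_sum_le:
  fixes q :: real
  assumes "0 \<le> q" "q \<le> 1 / 2"
  shows "(\<Sum>m<n. q ^ m) \<le> 2"
proof -
  have "(\<Sum>m<n. q ^ m) \<le> (\<Sum>m<n. (1 / 2) ^ m)"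
    using assms by (intro sum_mono power_mono)
  also have "\<dots> \<le> 2"
    by (simp add: geometric_sum)
  finally show ?thesis .
qed

text \<open>Words of length \<open>n\<close> have total weight at most \<open>(1 / 2) ^ n\<close> at
  a suitable exponent. This later keeps the set whose infimum is \<open>crit_exp\<close>
  nonempty.\<close>

lemma FG_wbound_exists:
  obtains s b where "s > 0" "wbound s (FG d) b"
proof -
  define L where "L n = {w :: word. length w = n \<and> (\<forall>x\<in>set w. fst x < d)}" for n
  \<comment> \<open>Each of the \<open>2 * d\<close> letters gets weight
    \<open>1 / (4 * d + 2)\<close>, together at most 1/2; the summand 2 keeps \<open>s\<close>
    positive when \<open>d = 0\<close>.\<close>
  define s where "s = ln (real (4 * d + 2))"
  have s: "s > 0" "exp (- s) = 1 / real (4 * d + 2)"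
    by (simp_all add: s_def exp_minus inverse_eq_divide)
  have L1: "wbound s (L 1) (1 / 2)"
  proof (rule wboundI)
    fix F assume F: "finite F" "F \<subseteq> L 1"
    have "F \<subseteq> (\<lambda>x. [x]) ` ({..<d} \<times> UNIV)"
      using F(2) by (force simp: L_def length_Suc_conv)
    then have "card F \<le> card ((\<lambda>x. [x]) ` ({..<d} \<times> (UNIV :: bool set)))"
      by (intro card_mono) auto
    also have "\<dots> \<le> d * 2"
      by (rule card_image_le[THEN order_trans]) (auto simp: card_cartesian_product)
    finally have "real (card F) \<le> 2 * real d" by linarith
    moreover have "(\<Sum>w\<in>F. exp (- s * real (length w))) = (\<Sum>w\<in>F. 1 / real (4 * d + 2))"
      using F s(2) by (intro sum.cong) (auto simp: L_def)
    ultimately have "(\<Sum>w\<in>F. exp (- s * real (length w))) \<le> 2 * real d / real (4 * d + 2)"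
      by (simp add: divide_right_mono)
    also have "\<dots> \<le> 1 / 2"
      by (simp add: divide_simps)
    finally show "(\<Sum>w\<in>F. exp (- s * real (length w))) \<le> 1 / 2" .
  qed
  have "wbound s (L n) ((1 / 2) ^ n)" for n
  proof (induction n)
    case 0
    have "L 0 = {[]}" by (auto simp: L_def)
    then show ?case using wbound_singleton[of s "[]"] by simp
  next
    case (Suc n)
    have "L (Suc n) \<subseteq> {u @ v |u v. u \<in> L 1 \<and> v \<in> L n}"
    proof
      fix w assume "w \<in> L (Suc n)"
      then obtain x v where "w = [x] @ v" "[x] \<in> L 1" "v \<in> L n"
        by (cases w) (auto simp: L_def)
      then show "w \<in> {u @ v |u v. u \<in> L 1 \<and> v \<in> L n}" by blast
    qed
    with wbound_append[OF L1 Suc] show ?case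
      by (auto intro: wbound_mono)
  qed
  then have "wbound s (\<Union>n. L n) 2"
    by (rule wbound_UN) (rule geometric_partial_sum_le, auto)
  then have "wbound s (FG d) 2"
    by (rule wbound_mono) (auto simp: L_def FG_iff)
  with s(1) that show ?thesis by blast
qed

section \<open>Adjoining one element\<close>

text \<open>In the situation below, \<open>t True\<close> generates together with \<open>\<Gamma>\<close> a free product in which all
  cancellation stays inside the words \<open>U b\<close>: the syllables \<open>W b\<close> survive in reduced words.
  \<open>T m b\<close> consists of the reduced words that may follow a syllable \<open>W b\<close> and contain \<open>m\<close>
  further syllables.\<close>

locale adjoin =
  fixes d :: nat and \<Gamma> :: "word set" and U W :: "bool \<Rightarrow> word"
  assumes subgroup: "is_subgroup d \<Gamma>"
    and U_nonempty: "U b \<noteq> []"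
    and W_nonempty: "W b \<noteq> []"
    and finv_W: "finv (W b) = W (\<not> b)"
    and reduced_UWU: "reduced (U b @ W b @ finv (U (\<not> b)))"
    and last_mult: "\<gamma> \<in> \<Gamma> \<Longrightarrow> nf (\<gamma> @ U b) \<noteq> [] \<and> last (nf (\<gamma> @ U b)) = last (U b)"
    and last_conj: "\<gamma> \<in> \<Gamma> \<Longrightarrow> \<gamma> \<noteq> [] \<or> b \<noteq> b' \<Longrightarrow>
      nf (finv (U b) @ \<gamma> @ U b') \<noteq> [] \<and> last (nf (finv (U b) @ \<gamma> @ U b')) = last (U b')"
begin

definition t :: "bool \<Rightarrow> word" where
  "t b = U b @ W b @ finv (U (\<not> b))"

primrec T :: "nat \<Rightarrow> bool \<Rightarrow> word set" where
  "T 0 b = {nf (finv (U (\<not> b)) @ \<gamma>) |\<gamma>. \<gamma> \<in> \<Gamma>}"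
| "T (Suc m) b = {nf (finv (U (\<not> b)) @ \<gamma> @ U b') @ W b' @ z |\<gamma> b' z.
     \<gamma> \<in> \<Gamma> \<and> (\<gamma> \<noteq> [] \<or> b' = b) \<and> z \<in> T m b'}"

text \<open>Normal forms with \<open>Suc m\<close> syllables, sorted by the sign \<open>b\<close> of
  the first one.\<close>

definition E :: "nat \<Rightarrow> bool \<Rightarrow> word set" where
  "E m b = {nf (\<gamma> @ U b) @ W b @ z |\<gamma> z. \<gamma> \<in> \<Gamma> \<and> z \<in> T m b}"

definition D :: "word set" where
  "D = \<Gamma> \<union> (\<Union>m. E m True \<union> E m False)"

lemma finv_t: "finv (t b) = t (\<not> b)"
  by (simp add: t_def finv_W)

lemma hd_conj:
  assumes "\<gamma> \<in> \<Gamma>" "\<gamma> \<noteq> [] \<or> b \<noteq> b'"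
  shows "hd (nf (finv (U b) @ \<gamma> @ U b')) = hd (finv (U b))"
proof -
  have "nf (finv (U b) @ \<gamma> @ U b') = finv (nf (finv (U b') @ finv \<gamma> @ U b))"
    by (simp flip: nf_finv)
  then show ?thesis
    using last_conj[of "finv \<gamma>" b' b] assms subgroup_finv[OF subgroup]
    by (simp add: hd_finv U_nonempty)
qed

text \<open>Every seam already occurs in some \<open>U b @ W b @ finv (U (\<not> b))\<close>, since
  the pieces between syllables keep their outer letters. The claim on \<open>hd z\<close> lets the
  induction treat the next seam.\<close>

lemma T_reduced:
  "z \<in> T m b \<Longrightarrow> z \<noteq> [] \<and> hd z = hd (finv (U (\<not> b))) \<and> reduced (W b @ z)"
proof (induction m arbitrary: b z)
  case 0
  then obtain \<gamma> where \<gamma>: "\<gamma> \<in> \<Gamma>" "z = nf (finv (U (\<not> b)) @ \<gamma>)" by auto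
  then have "z = finv (nf (finv \<gamma> @ U (\<not> b)))"
    by (simp flip: nf_finv)
  with last_mult[OF subgroup_finv[OF subgroup \<gamma>(1)], of "\<not> b"]
  have "z \<noteq> []" "hd z = hd (finv (U (\<not> b)))"
    by (simp_all add: hd_finv U_nonempty)
  with reduced_UWU[of b] \<gamma>(2) show ?case
    by (auto simp: reduced_append hd_append U_nonempty)
next
  case (Suc m)
  then obtain \<gamma> b' z' where z: "\<gamma> \<in> \<Gamma>" "\<gamma> \<noteq> [] \<or> b' = b" "z' \<in> T m b'"
    "z = nf (finv (U (\<not> b)) @ \<gamma> @ U b') @ W b' @ z'"
    by auto
  have 1: "reduced (W b' @ z')"
    using Suc.IH z(3) by blast
  have 2: "nf (finv (U (\<not> b)) @ \<gamma> @ U b') \<noteq> []"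
    "last (nf (finv (U (\<not> b)) @ \<gamma> @ U b')) = last (U b')"
    "hd (nf (finv (U (\<not> b)) @ \<gamma> @ U b')) = hd (finv (U (\<not> b)))"
    using last_conj[of \<gamma> "\<not> b" b'] hd_conj[of \<gamma> "\<not> b" b'] z(1,2) by auto
  show ?case
    using 1 2 reduced_UWU[of b'] reduced_UWU[of b]
    by (auto simp: z(4) reduced_append hd_append U_nonempty W_nonempty)
qed

lemma E_reduced: "w \<in> E m b \<Longrightarrow> reduced w"
  unfolding E_def using last_mult T_reduced reduced_UWU[of b]
  by (auto simp: reduced_append hd_append U_nonempty W_nonempty)

lemma D_cases:
  assumes "w \<in> D"
  obtains "w \<in> \<Gamma>" | \<gamma> b m z where "\<gamma> \<in> \<Gamma>" "z \<in> T m b" "w = nf (\<gamma> @ U b) @ W b @ z"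
  using assms by (auto simp: D_def E_def)

lemma in_D_I:
  assumes "\<gamma> \<in> \<Gamma>" "z \<in> T m b" "nf w = nf (\<gamma> @ U b @ W b @ z)"
  shows "nf w \<in> D"
proof -
  have *: "nf (\<gamma> @ U b) @ W b @ z \<in> E m b"
    using assms by (auto simp: E_def)
  have "nf w = nf (nf (\<gamma> @ U b) @ W b @ z)"
    using assms(3) by simp
  also have "\<dots> = nf (\<gamma> @ U b) @ W b @ z"
    using E_reduced[OF *] by (rule nf_reduced)
  finally show ?thesis
    using * by (cases b) (auto simp: D_def)
qed

lemma D_mult_subgroup:
  assumes "w \<in> D" "\<gamma> \<in> \<Gamma>"
  shows "nf (\<gamma> @ w) \<in> D"
  using assms(1)
proof (cases rule: D_cases)
  case 1
  then show ?thesis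
    using subgroup_mult[OF subgroup assms(2)] by (auto simp: D_def)
next
  case (2 \<gamma>' b m z)
  show ?thesis
    by (rule in_D_I[OF subgroup_mult[OF subgroup assms(2) 2(1)] 2(2)]) (simp add: 2(3))
qed

text \<open>Left multiplication by \<open>t b\<close> adds a syllable, unless it directly meets its
  own inverse; then the two cancel and one syllable is lost.\<close>

lemma D_mult_t:
  assumes "w \<in> D"
  shows "nf (t b @ w) \<in> D"
  using assms
proof (cases rule: D_cases)
  case 1
  then have "nf (finv (U (\<not> b)) @ w) \<in> T 0 b" by auto
  moreover have "nf (t b @ w) = nf ([] @ U b @ W b @ nf (finv (U (\<not> b)) @ w))"
    using nf_append_nf[of "U b @ W b" "finv (U (\<not> b)) @ w"] by (simp add: t_def)
  ultimately show ?thesis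
    using in_D_I[OF subgroup_Nil[OF subgroup]] by blast
next
  case (2 \<gamma> b' m z)
  show ?thesis
  proof (cases "\<gamma> \<noteq> [] \<or> b' = b")
    case True
    let ?z = "nf (finv (U (\<not> b)) @ \<gamma> @ U b') @ W b' @ z"
    have "?z \<in> T (Suc m) b"
      using True 2 by auto
    moreover have "nf (t b @ w) = nf ([] @ U b @ W b @ ?z)"
      using nf_append_nf_append[of "U b @ W b" "finv (U (\<not> b)) @ \<gamma> @ U b'" "W b' @ z"]
        nf_append_nf_append[of "t b" "\<gamma> @ U b'" "W b' @ z"]
      by (simp add: t_def 2(3))
    ultimately show ?thesis
      using in_D_I[OF subgroup_Nil[OF subgroup]] by blast
  next
    case False
    then have b': "b' = (\<not> b)" and "\<gamma> = []" by auto
    have "nf (t b @ w) = nf ((U b @ W b) @ finv (U (\<not> b)) @ U (\<not> b) @ finv (W b) @ z)"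
      using \<open>\<gamma> = []\<close> nf_append_nf_append[of "t b" "U b'" "W b' @ z"]
      by (simp add: 2(3) b' t_def finv_W)
    also have "\<dots> = nf (U b @ W b @ finv (W b) @ z)"
      by (simp only: nf_inv_left_mid) simp
    also have "\<dots> = nf (U b @ z)"
      by (simp only: nf_inv_right_mid)
    finally have tw: "nf (t b @ w) = nf (U b @ z)" .
    \<comment> \<open>The tail \<open>z\<close> starts from \<open>finv (U b)\<close>, which absorbs
      the remaining \<open>U b\<close>: for \<open>m = 0\<close> an element of
      \<open>\<Gamma>\<close> is left, otherwise the next syllable takes the lead.\<close>
    show ?thesis
    proof (cases m)
      case 0
      then obtain \<gamma>' where "\<gamma>' \<in> \<Gamma>" "z = nf (finv (U b) @ \<gamma>')"
        using 2(2) b' by auto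
      then show ?thesis
        using subgroup_reduced[OF subgroup] by (simp add: tw D_def nf_reduced)
    next
      case (Suc k)
      then obtain \<gamma>' b'' z' where z: "\<gamma>' \<in> \<Gamma>" "z' \<in> T k b''"
        "z = nf (finv (U b) @ \<gamma>' @ U b'') @ W b'' @ z'"
        using 2(2) b' by auto
      show ?thesis
        by (rule in_D_I[OF z(1,2)]) (simp add: tw z(3))
    qed
  qed
qed

text \<open>\<open>D\<close> contains the identity and is closed under left multiplication by
  \<open>\<Gamma>\<close> and by both \<open>t b\<close>, which is all that induction on products of
  generators asks for.\<close>

lemma gen_subgroup_subset_D:
  assumes "S \<subseteq> FG d" "\<Gamma> = gen_subgroup d S" "t True \<in> FG d"
  shows "gen_subgroup d (insert (t True) S) \<subseteq> D"
proof
  fix w assume "w \<in> gen_subgroup d (insert (t True) S)"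
  with assms(1,3) have "insert (t True) S \<subseteq> FG d" "w \<in> gen_subgroup d (insert (t True) S)"
    by auto
  then show "w \<in> D"
  proof (induction rule: gen_subgroup_left_induct)
    case Nil
    then show ?case by (simp add: D_def subgroup_Nil[OF subgroup])
  next
    case (mult s w)
    have "s \<in> \<Gamma> \<or> s = t True \<or> s = t False"
      using mult(1) gen_subgroup_superset[of S d] subgroup_finv[OF subgroup]
      by (auto simp: assms(2) finv_t)
    then show ?case
      using mult(2) D_mult_subgroup D_mult_t by auto
  qed
qed

section \<open>Exponential sums over the normal forms\<close>

lemma wbound_conj:
  assumes "wbound s \<Gamma> p" "s > 0" "length u \<le> K" "length v \<le> K"
  shows "wbound s {nf (u @ \<gamma> @ v) |\<gamma>. \<gamma> \<in> \<Gamma>} (exp (2 * s * real K) * p)"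
proof -
  have "wbound s ((\<lambda>\<gamma>. nf (u @ \<gamma> @ v)) ` \<Gamma>) (exp (2 * s * real K) * p)"
  proof (rule wbound_image[OF assms(1)])
    fix \<gamma> assume "\<gamma> \<in> \<Gamma>"
    \<comment> \<open>Undoing both multiplications shows that they shorten \<open>\<gamma>\<close>
      by at most \<open>2 * K\<close>.\<close>
    have "nf (finv u @ nf (u @ \<gamma> @ v) @ finv v) = nf (nf (finv u @ u @ (\<gamma> @ v)) @ finv v)"
      by (simp only: nf_append_nf_append nf_nf_append append.assoc)
    also have "\<dots> = nf \<gamma>"
      by (simp only: nf_inv_left) simp
    also have "\<dots> = \<gamma>"
      using \<open>\<gamma> \<in> \<Gamma>\<close> subgroup_reduced[OF subgroup] by (simp add: nf_reduced)
    finally have "length \<gamma> \<le> length (finv u @ nf (u @ \<gamma> @ v) @ finv v)"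
      by (metis length_nf_le)
    then have "real (length \<gamma>) \<le> real (length (nf (u @ \<gamma> @ v))) + 2 * real K"
      using assms(3,4) by simp
    then have "s * real (length \<gamma>) \<le> s * (real (length (nf (u @ \<gamma> @ v))) + 2 * real K)"
      using assms(2) by (intro mult_left_mono) auto
    then show "exp (- s * real (length (nf (u @ \<gamma> @ v))))
        \<le> exp (2 * s * real K) * exp (- s * real (length \<gamma>))"
      by (simp add: algebra_simps flip: exp_add)
  qed simp
  then show ?thesis
    by (simp add: image_def Bex_def conj_commute)
qed

text \<open>Each further syllable costs a factor \<open>\<theta>\<close>: two signs, the weight
  \<open>exp (- s * real l)\<close> of the syllable, and \<open>Q\<close> for the piece between
  syllables. Summing over the number of syllables gives a geometric series of ratio at most
  1/2.\<close>

lemma wbound_adjoin: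
  assumes "S \<subseteq> FG d" "\<Gamma> = gen_subgroup d S" "t True \<in> FG d"
    and "wbound s \<Gamma> p" "s > 0" "\<And>b. length (U b) \<le> K" "\<And>b. length (W b) = l"
    and Q: "Q = exp (2 * s * real K) * p"
    and \<theta>: "\<theta> = 2 * exp (- s * real l) * Q" "\<theta> \<le> 1 / 2"
  shows "wbound s (gen_subgroup d (insert (t True) S) - \<Gamma>) (2 * \<theta> * Q)"
proof -
  have Q0: "Q \<ge> 0"
    using wbound_nonneg[OF assms(4)] by (simp add: Q)
  then have \<theta>0: "\<theta> \<ge> 0" by (simp add: \<theta>)
  note conj = wbound_conj[OF assms(4,5), of _ K, folded Q]
  have syllable: "wbound s {a @ W b @ z |a z. a \<in> A \<and> z \<in> B} (\<theta> / 2 * c)"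
    if "wbound s A Q" "wbound s B c" for A B b c
  proof -
    have "wbound s {a @ v |a v. a \<in> A \<and> v \<in> {u @ z |u z. u \<in> {W b} \<and> z \<in> B}}
        (Q * (exp (- s * real (length (W b))) * c))"
      by (intro wbound_append that wbound_singleton)
    moreover have "Q * (exp (- s * real (length (W b))) * c) = \<theta> / 2 * c"
      by (simp add: \<theta> assms(7))
    ultimately show ?thesis
      by (auto elim!: wbound_mono)
  qed
  have T: "wbound s (T m b) (Q * \<theta> ^ m)" for m b
  proof (induction m arbitrary: b)
    case 0
    have "wbound s {nf (finv (U (\<not> b)) @ \<gamma> @ []) |\<gamma>. \<gamma> \<in> \<Gamma>} Q"
      using assms(6) by (intro conj) auto
    then show ?case by simp
  next
    case (Suc m)
    \<comment> \<open>Enlarging \<open>T (Suc m) b\<close> to all pairs of \<open>\<gamma>\<close>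
      and \<open>b'\<close> splits the sum into one product for each sign.\<close>
    let ?A = "\<lambda>b'. {nf (finv (U (\<not> b)) @ \<gamma> @ U b') |\<gamma>. \<gamma> \<in> \<Gamma>}"
    let ?X = "\<lambda>b'. {a @ W b' @ z |a z. a \<in> ?A b' \<and> z \<in> T m b'}"
    have "wbound s (?X b') (\<theta> / 2 * (Q * \<theta> ^ m))" for b'
      using assms(6) by (intro syllable conj Suc) auto
    then have "wbound s (?X True \<union> ?X False) (\<theta> / 2 * (Q * \<theta> ^ m) + \<theta> / 2 * (Q * \<theta> ^ m))"
      by (intro wbound_Un)
    then show ?case
    proof (rule wbound_mono)
      show "T (Suc m) b \<subseteq> ?X True \<union> ?X False"
      proof
        fix w assume "w \<in> T (Suc m) b"
        then obtain \<gamma> b' z where "\<gamma> \<in> \<Gamma>" "z \<in> T m b'"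
          "w = nf (finv (U (\<not> b)) @ \<gamma> @ U b') @ W b' @ z"
          by auto
        then have "w \<in> ?X b'" by blast
        then show "w \<in> ?X True \<union> ?X False" by (cases b') (auto simp only: Un_iff)
      qed
    qed (simp add: algebra_simps)
  qed
  have E: "wbound s (E m b) (\<theta> / 2 * (Q * \<theta> ^ m))" for m b
  proof -
    have "wbound s {nf ([] @ \<gamma> @ U b) |\<gamma>. \<gamma> \<in> \<Gamma>} Q"
      using assms(6) by (intro conj) auto
    then have "wbound s {a @ W b @ z |a z. a \<in> {nf ([] @ \<gamma> @ U b) |\<gamma>. \<gamma> \<in> \<Gamma>} \<and> z \<in> T m b}
        (\<theta> / 2 * (Q * \<theta> ^ m))"
      by (intro syllable T)
    then show ?thesis
      by (rule wbound_mono) (auto simp: E_def)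
  qed
  have "wbound s (\<Union>m. E m True \<union> E m False) (2 * \<theta> * Q)"
  proof (rule wbound_UN)
    show "wbound s (E m True \<union> E m False) (\<theta> / 2 * (Q * \<theta> ^ m) + \<theta> / 2 * (Q * \<theta> ^ m))" for m
      by (intro wbound_Un E)
    have "(\<Sum>m<n. \<theta> / 2 * (Q * \<theta> ^ m) + \<theta> / 2 * (Q * \<theta> ^ m)) = \<theta> * Q * (\<Sum>m<n. \<theta> ^ m)" for n
      by (simp add: sum_distrib_left mult_ac)
    also have "\<theta> * Q * (\<Sum>m<n. \<theta> ^ m) \<le> \<theta> * Q * 2" for n
      using \<theta>0 \<theta>(2) Q0 by (intro mult_left_mono geometric_partial_sum_le) auto
    finally show "(\<Sum>m<n. \<theta> / 2 * (Q * \<theta> ^ m) + \<theta> / 2 * (Q * \<theta> ^ m)) \<le> 2 * \<theta> * Q" for n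
      by (simp add: mult_ac)
  qed
  then show ?thesis
    by (rule wbound_mono) (use gen_subgroup_subset_D[OF assms(1-3)] in \<open>auto simp: D_def\<close>)
qed

end

section \<open>Axes leaving the core\<close>

lemma append_eq_append_prefix:
  assumes "u @ v = w @ z" "length w \<le> length u"
  obtains q where "u = w @ q" "z = q @ v"
  using assms by (metis append_eq_append_conv_if append_take_drop_id)

text \<open>Here \<open>x c x\<^sup>-\<^sup>1\<close> is an element whose axis eventually leaves, in both directions, the convex hull
  of \<open>\<Gamma>\<close> in the Cayley tree.\<close>

locale axis =
  fixes d :: nat and \<Gamma> :: "word set" and x c :: word and n\<^sub>0 :: nat
  fixes cs :: "bool \<Rightarrow> word" and V :: "bool \<Rightarrow> nat \<Rightarrow> word"
  defines "cs \<equiv> \<lambda>b. if b then c else finv c"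
    and "V \<equiv> \<lambda>b n. x @ wpow (cs b) n"
  assumes subgroup: "is_subgroup d \<Gamma>"
    and reduced_xcx: "reduced (x @ c @ finv x)"
    and c_nonempty: "c \<noteq> []"
    and reduced_cc: "reduced (c @ c)"
    and leaves: "V b n\<^sub>0 @ r \<notin> \<Gamma>"
begin

lemma cs_nonempty: "cs b \<noteq> []"
  using c_nonempty by (simp add: cs_def)

lemma length_cs [simp]: "length (cs b) = length c"
  by (simp add: cs_def)

lemma finv_cs: "finv (cs b) = cs (\<not> b)"
  by (simp add: cs_def)

lemma reduced_cs: "reduced (x @ cs b @ finv x)" "reduced (cs b @ cs b)"
  using reduced_xcx reduced_cc reduced_finv[of "x @ c @ finv x"] reduced_finv[of "c @ c"]
  by (simp_all add: cs_def)

lemma reduced_V: "reduced (V b n)"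
  unfolding V_def by (intro reduced_conj_wpow reduced_cs cs_nonempty)

lemma length_V: "length (V b n) = length x + n * length c"
  by (simp add: V_def)

lemma V_add: "V b (m + n) = V b m @ wpow (cs b) n"
  by (simp add: V_def wpow_add)

lemma nf_conj_V: "nf ((x @ cs b @ finv x) @ V b n) = nf (V b (Suc n))"
  using nf_inv_left_mid[of "x @ cs b" x "wpow (cs b) n"] by (simp add: V_def wpow_Suc)

text \<open>Cancelling as much as \<open>V b n\<^sub>0\<close> would make
  \<open>V b n\<^sub>0\<close> a prefix of \<open>finv \<gamma>\<close>, contrary to
  \<open>leaves\<close>. So cancellation is bounded independently of \<open>n\<close>.\<close>

lemma mult_V_split:
  assumes "\<gamma> \<in> \<Gamma>" "n \<ge> n\<^sub>0"
  obtains a r e where "\<gamma> = a @ r" "V b n = finv r @ e" "nf (\<gamma> @ V b n) = a @ e"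
    "length r < length (V b n\<^sub>0)"
proof -
  obtain a r e where *: "\<gamma> = a @ r" "V b n = finv r @ e" "nf (\<gamma> @ V b n) = a @ e"
    using nf_append_split[OF subgroup_reduced[OF subgroup assms(1)] reduced_V] .
  have "length r < length (V b n\<^sub>0)"
  proof (rule ccontr)
    assume "\<not> length r < length (V b n\<^sub>0)"
    moreover have "finv r @ e = V b n\<^sub>0 @ wpow (cs b) (n - n\<^sub>0)"
      using *(2) V_add[of b n\<^sub>0 "n - n\<^sub>0"] assms(2) by simp
    ultimately obtain q where "finv r = V b n\<^sub>0 @ q"
      by (auto elim: append_eq_append_prefix)
    then have "finv \<gamma> = V b n\<^sub>0 @ q @ finv a"
      by (simp add: *(1))
    then show False
      using subgroup_finv[OF subgroup assms(1)] leaves by metis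
  qed
  with * that show ?thesis by blast
qed

text \<open>Such a \<open>\<gamma>\<close> maps the axis to itself. Compare \<open>\<gamma>\<close>
  times a far point of the axis with the far point it must stay near: the product begins with the
  uncancelled part \<open>a\<close> of \<open>\<gamma>\<close> and also with
  \<open>V b' n\<^sub>0\<close>, so \<open>leaves\<close> makes \<open>a\<close> short; the
  cancelled part is short by the previous lemma.\<close>

lemma length_axis_stabiliser:
  assumes "\<gamma> \<in> \<Gamma>" and comm: "nf (\<gamma> @ x @ cs b @ finv x) = nf ((x @ cs b' @ finv x) @ \<gamma>)"
  shows "length \<gamma> < 2 * length (V b n\<^sub>0)"
proof -
  \<comment> \<open>The surplus over \<open>n\<^sub>0\<close> bounds the length of the conjugate of
    \<open>\<gamma>\<close> by \<open>x\<close>, so cancelling against that conjugate leaves the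
    first \<open>n\<^sub>0\<close> periods intact.\<close>
  define N where "N = n\<^sub>0 + (length \<gamma> + 2 * length x)"
  let ?g = "\<lambda>b. x @ cs b @ finv x"
  have "nf (\<gamma> @ wpow (?g b) n) = nf (wpow (?g b') n @ \<gamma>)" for n
  proof (induction n)
    case (Suc n)
    have "nf (\<gamma> @ wpow (?g b) (Suc n)) = nf (nf (\<gamma> @ wpow (?g b) n) @ ?g b)"
      by (simp add: wpow_Suc2)
    also have "\<dots> = nf (wpow (?g b') n @ nf (\<gamma> @ ?g b))"
      unfolding Suc by simp
    also have "\<dots> = nf (wpow (?g b') (Suc n) @ \<gamma>)"
      unfolding comm by (simp add: wpow_Suc2)
    finally show ?case .
  qed simp
  from this[of N] have "nf (\<gamma> @ nf (wpow (?g b) N)) = nf (nf (wpow (?g b') N) @ \<gamma>)"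
    by (simp only: nf_append_nf nf_nf_append)
  then have "nf (\<gamma> @ x @ wpow (cs b) N @ finv x) = nf ((x @ wpow (cs b') N @ finv x) @ \<gamma>)"
    by (simp only: nf_wpow_conj nf_append_nf nf_nf_append)
  then have "nf ((\<gamma> @ x @ wpow (cs b) N @ finv x) @ x) = nf (((x @ wpow (cs b') N @ finv x) @ \<gamma>) @ x)"
    by (rule nf_append_cong) (rule refl)
  then have eq: "nf (\<gamma> @ V b N) = nf (V b' N @ nf (finv x @ \<gamma> @ x))"
    using nf_inv_left_end(2)[of "\<gamma> @ x @ wpow (cs b) N" x]
      nf_append_nf[of "x @ wpow (cs b') N" "finv x @ \<gamma> @ x"] by (simp add: V_def)
  obtain a r e where are: "\<gamma> = a @ r" "nf (\<gamma> @ V b N) = a @ e" "length r < length (V b n\<^sub>0)"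
    using mult_V_split[OF assms(1), of N b] unfolding N_def by (metis le_add1)
  obtain p q f where pqf: "V b' N = p @ q" "nf (finv x @ \<gamma> @ x) = finv q @ f"
    "nf (V b' N @ nf (finv x @ \<gamma> @ x)) = p @ f"
    using nf_append_split[OF reduced_V reduced_nf] .
  have "length q \<le> length (nf (finv x @ \<gamma> @ x))"
    by (simp add: pqf(2))
  also have "\<dots> \<le> length \<gamma> + 2 * length x"
    using length_nf_le[of "finv x @ \<gamma> @ x"] by simp
  also have "\<dots> \<le> (length \<gamma> + 2 * length x) * length c"
    using c_nonempty by (cases c) auto
  finally have "length q \<le> (length \<gamma> + 2 * length x) * length c" .
  moreover have "length p + length q = length x + N * length c"
    using arg_cong[OF pqf(1), of length] by (simp add: length_V)
  ultimately have "length (V b' n\<^sub>0) \<le> length p"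
    by (simp add: length_V N_def add_mult_distrib)
  moreover have "p @ q = V b' n\<^sub>0 @ wpow (cs b') (length \<gamma> + 2 * length x)"
    using pqf(1) by (simp add: N_def V_add)
  ultimately obtain p' where "p = V b' n\<^sub>0 @ p'"
    by (auto elim: append_eq_append_prefix)
  then have ae: "a @ e = V b' n\<^sub>0 @ p' @ f"
    using eq are(2) pqf(3) by simp
  have "length a < length (V b' n\<^sub>0)"
  proof (rule ccontr)
    assume "\<not> length a < length (V b' n\<^sub>0)"
    with ae obtain a' where "a = V b' n\<^sub>0 @ a'"
      by (auto elim: append_eq_append_prefix)
    then have "V b' n\<^sub>0 @ a' @ r \<in> \<Gamma>"
      using assms(1) are(1) by simp
    then show False using leaves by blast
  qed
  with are show ?thesis by (simp add: length_V)
qed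

text \<open>All powers of \<open>\<gamma>\<close> preserve the axis too, so their lengths are
  uniformly bounded; a nontrivial element has powers of unbounded length.\<close>

lemma axis_stabiliser_trivial:
  assumes "\<gamma> \<in> \<Gamma>" and comm: "nf (\<gamma> @ x @ cs b @ finv x) = nf ((x @ cs b' @ finv x) @ \<gamma>)"
  shows "\<gamma> = []"
proof (rule ccontr)
  assume "\<gamma> \<noteq> []"
  let ?g = "\<lambda>b. x @ cs b @ finv x"
  \<comment> \<open>Since \<open>\<gamma>\<close> may reverse the axis, iterating it needs the
    relation for both signs; the other sign follows by inverting.\<close>
  have flip: "\<exists>b''. nf (\<gamma> @ ?g b1) = nf (?g b'' @ \<gamma>)" for b1
  proof (cases "b1 = b")
    case False
    then have g1: "?g b1 = finv (?g b)"
      by (simp add: finv_cs)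
    have "nf (?g b @ finv \<gamma> @ finv (?g b')) = nf (finv \<gamma> @ nf (\<gamma> @ ?g b) @ finv \<gamma> @ finv (?g b'))"
      using nf_inv_left[of \<gamma> "?g b @ finv \<gamma> @ finv (?g b')"]
        nf_append_nf_append[of "finv \<gamma>" "\<gamma> @ ?g b" "finv \<gamma> @ finv (?g b')"] by simp
    also have "\<dots> = nf (finv \<gamma> @ nf (?g b' @ \<gamma> @ finv \<gamma> @ finv (?g b')))"
      unfolding comm
      using nf_append_nf_append[of "finv \<gamma>" "?g b' @ \<gamma>" "finv \<gamma> @ finv (?g b')"] by simp
    also have "\<dots> = nf (finv \<gamma>)"
      by (simp only: nf_inv_right_mid nf_inv_right_end) simp
    finally have "nf (finv (?g b @ finv \<gamma> @ finv (?g b'))) = nf (finv (finv \<gamma>))"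
      unfolding nf_finv by simp
    then have "nf (?g b' @ \<gamma> @ finv (?g b)) = nf \<gamma>"
      by simp
    then have "nf (finv (?g b') @ nf (?g b' @ \<gamma> @ finv (?g b))) = nf (finv (?g b') @ \<gamma>)"
      by (simp only: nf_append_nf)
    then have "nf (\<gamma> @ finv (?g b)) = nf (finv (?g b') @ \<gamma>)"
      by (simp only: nf_append_nf nf_inv_left)
    then have "nf (\<gamma> @ ?g b1) = nf (?g (\<not> b') @ \<gamma>)"
      unfolding g1 by (simp add: finv_cs)
    then show ?thesis by blast
  qed (use comm in auto)
  have pow: "\<exists>b''. nf (wpow \<gamma> m @ ?g b1) = nf (?g b'' @ wpow \<gamma> m)" for m b1
  proof (induction m arbitrary: b1)
    case (Suc m)
    obtain b2 where b2: "nf (wpow \<gamma> m @ ?g b1) = nf (?g b2 @ wpow \<gamma> m)"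
      using Suc by blast
    obtain b3 where b3: "nf (\<gamma> @ ?g b2) = nf (?g b3 @ \<gamma>)"
      using flip by blast
    have "nf (wpow \<gamma> (Suc m) @ ?g b1) = nf (\<gamma> @ nf (wpow \<gamma> m @ ?g b1))"
      by (simp add: wpow_Suc)
    also have "\<dots> = nf (nf (\<gamma> @ ?g b2) @ wpow \<gamma> m)"
      unfolding b2 by simp
    also have "\<dots> = nf (?g b3 @ wpow \<gamma> (Suc m))"
      unfolding b3 by (simp add: wpow_Suc)
    finally show ?case by blast
  qed auto
  have "length (nf (wpow \<gamma> m)) < 2 * length (V b n\<^sub>0)" for m
  proof -
    obtain b'' where "nf (wpow \<gamma> m @ ?g b) = nf (?g b'' @ wpow \<gamma> m)"
      using pow by blast
    then have "nf (nf (wpow \<gamma> m) @ ?g b) = nf (?g b'' @ nf (wpow \<gamma> m))"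
      by (simp only: nf_append_nf nf_nf_append)
    moreover have "nf (wpow \<gamma> m) \<in> \<Gamma>"
      using assms(1) subgroup_reduced[OF subgroup] by (intro subgroup_wpow[OF subgroup]) (simp add: nf_reduced)
    ultimately show ?thesis
      by (rule length_axis_stabiliser[rotated])
  qed
  moreover have "m \<le> length (nf (wpow \<gamma> m))" for m
    using \<open>\<gamma> \<noteq> []\<close> subgroup_reduced[OF subgroup assms(1)]
    by (intro length_nf_wpow_ge) (simp add: nf_reduced)
  ultimately show False
    by (meson leD)
qed

text \<open>A long overlap of \<open>\<gamma>\<close> times one end of the axis with an end of the axis shifts both by one
  period, so \<open>\<gamma>\<close> conjugates \<open>x c x\<^sup>-\<^sup>1\<close> to itself or its inverse.\<close>

lemma overlap_trivial:
  assumes "\<gamma> \<in> \<Gamma>" and n: "n = n\<^sub>0 + Suc (length x)"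
    and prefix: "V b' n = nf (\<gamma> @ V b n) @ r"
  shows "\<gamma> = []"
proof -
  \<comment> \<open>One period fewer than \<open>n\<close>: the last period of \<open>V b n\<close>
    will be split off and compared with a period at the other axis end.\<close>
  define k where "k = n\<^sub>0 + length x"
  have nk: "n = Suc k" by (simp add: n k_def)
  obtain a q e where aqe: "\<gamma> = a @ q" "V b n = finv q @ e" "nf (\<gamma> @ V b n) = a @ e"
    "length q < length (V b n\<^sub>0)"
    using mult_V_split[OF assms(1), of n b] by (auto simp: n)
  have c1: "length c \<ge> 1"
    using c_nonempty by (cases c) auto
  have len: "length q + length e = length x + n * length c"
    using arg_cong[OF aqe(2), of length] by (simp add: length_V)
  then have e: "length e > (length x + 1) * length c"
    using aqe(4) by (simp add: length_V n algebra_simps)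
  \<comment> \<open>The cancelled part \<open>q\<close> ends before the last period, so a full
    factor \<open>cs b\<close> survives in the product.\<close>
  have "finv q @ e = V b k @ cs b"
    using aqe(2) by (simp add: nk V_def wpow_Suc2)
  moreover have "length (finv q) \<le> length (V b k)"
    using len e by (simp add: length_V nk)
  ultimately obtain e1 where e1: "e = e1 @ cs b" "V b k = finv q @ e1"
    using append_eq_append_prefix[of "V b k" "cs b" "finv q" e] by metis
  have "length x * 1 \<le> length x * length c"
    using c1 by (rule mult_le_mono2)
  moreover have "length x * length c < length e1"
    using e by (simp add: e1(1))
  ultimately have "length (a @ e1) \<ge> length x"
    unfolding length_append by linarith
  moreover have "(a @ e1) @ cs b @ r = x @ wpow (cs b') n"
    using prefix unfolding aqe(3) e1(1) by (simp add: V_def)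
  ultimately obtain P where P: "a @ e1 = x @ P" "wpow (cs b') n = P @ cs b @ r"
    using append_eq_append_prefix[of "a @ e1" "cs b @ r" x "wpow (cs b') n"] by metis
  \<comment> \<open>A further period may be added to a power of \<open>cs b'\<close> at either end;
    comparing prefixes of equal length yields the shift relation \<open>period\<close>.\<close>
  have "cs b' @ P @ cs b @ r = wpow (cs b') n @ cs b'"
    unfolding P(2)[symmetric] by (simp flip: wpow_Suc wpow_Suc2)
  then have "(cs b' @ P) @ cs b @ r = (P @ cs b) @ r @ cs b'"
    by (simp add: P(2))
  then have period: "cs b' @ P = P @ cs b"
    by (subst (asm) append_eq_append_conv) auto
  have P1: "nf (\<gamma> @ V b k) = nf (x @ P)"
    using nf_inv_right_mid[of a q e1] by (simp add: aqe(1) e1(2) P(1))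
  \<comment> \<open>Both sides of the desired commutation are applied to the point
    \<open>V b k\<close>; agreement there suffices, by right cancellation.\<close>
  have "nf ((\<gamma> @ x @ cs b @ finv x) @ V b k) = nf (\<gamma> @ nf ((x @ cs b @ finv x) @ V b k))"
    by simp
  also have "\<dots> = nf (\<gamma> @ V b n)"
    unfolding nf_conj_V by (simp add: nk)
  also have "\<dots> = nf ((x @ P) @ cs b)"
    using aqe(3) by (metis P(1) append.assoc e1(1) nf_nf)
  also have "\<dots> = nf ((x @ cs b' @ finv x) @ (x @ P))"
    using nf_inv_left_mid[of "x @ cs b'" x P] period by simp
  also have "\<dots> = nf ((x @ cs b' @ finv x) @ nf (x @ P))"
    by (simp only: nf_append_nf)
  also have "\<dots> = nf (((x @ cs b' @ finv x) @ \<gamma>) @ V b k)"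
    unfolding P1[symmetric] nf_append_nf by simp
  finally have "nf (\<gamma> @ x @ cs b @ finv x) = nf ((x @ cs b' @ finv x) @ \<gamma>)"
    by (rule nf_cancel_right)
  with assms(1) show ?thesis
    by (rule axis_stabiliser_trivial)
qed

text \<open>The outer \<open>n\<close> periods on each side are a buffer that absorbs all
  cancellation. As \<open>n\<close> does not depend on \<open>M\<close>, the middle syllable can be
  made arbitrarily long at a fixed cost.\<close>

lemma adjoin_axis:
  assumes n: "n = n\<^sub>0 + Suc (length x)" and "M > 0"
  shows "adjoin d \<Gamma> (\<lambda>b. V b n) (\<lambda>b. wpow (cs b) M)"
proof
  show "is_subgroup d \<Gamma>" by (rule subgroup)
  show V_nonempty: "V b n \<noteq> []" for b
    using cs_nonempty by (simp add: V_def n)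
  have last_V: "last (V b n) = last (cs b)" for b
    using cs_nonempty by (simp add: V_def n last_wpow)
  show "wpow (cs b) M \<noteq> []" for b
    using cs_nonempty \<open>M > 0\<close> by simp
  show "finv (wpow (cs b) M) = wpow (cs (\<not> b)) M" for b
    by (simp add: finv_wpow finv_cs)
  have "V b n @ wpow (cs b) M @ finv (V (\<not> b) n) = x @ wpow (cs b) (n + M + n) @ finv x" for b
    by (simp add: V_def wpow_add finv_wpow finv_cs)
  then show "reduced (V b n @ wpow (cs b) M @ finv (V (\<not> b) n))" for b
    using reduced_conj_wpow(2)[OF reduced_cs(1) cs_nonempty reduced_cs(2), of "n + M + n" b] \<open>M > 0\<close>
    by simp
  show last_mult: "nf (\<gamma> @ V b n) \<noteq> [] \<and> last (nf (\<gamma> @ V b n)) = last (V b n)"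
    if \<gamma>: "\<gamma> \<in> \<Gamma>" for \<gamma> b
  proof -
    obtain a q e where aqe: "\<gamma> = a @ q" "V b n = finv q @ e" "nf (\<gamma> @ V b n) = a @ e"
      "length q < length (V b n\<^sub>0)"
      using mult_V_split[OF \<gamma>, of n b] by (auto simp: n)
    moreover have "length (V b n\<^sub>0) \<le> length (V b n)"
      by (simp add: length_V n add_mult_distrib)
    ultimately have "e \<noteq> []" by auto
    with aqe show ?thesis by simp
  qed
  show "nf (finv (V b n) @ \<gamma> @ V b' n) \<noteq> [] \<and>
      last (nf (finv (V b n) @ \<gamma> @ V b' n)) = last (V b' n)"
    if "\<gamma> \<in> \<Gamma>" "\<gamma> \<noteq> [] \<or> b \<noteq> b'" for \<gamma> b b'
  proof (cases "\<gamma> = []")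
    case False
    obtain a r e where are: "finv (V b n) = a @ r" "nf (\<gamma> @ V b' n) = finv r @ e"
      "nf (finv (V b n) @ nf (\<gamma> @ V b' n)) = a @ e"
      using nf_append_split[of "finv (V b n)" "nf (\<gamma> @ V b' n)"] reduced_V by auto
    \<comment> \<open>If \<open>e\<close> were empty, \<open>\<gamma>\<close> times one axis end
      would be a prefix of the other, the overlap excluded for nontrivial
      \<open>\<gamma>\<close>.\<close>
    have "e \<noteq> []"
    proof
      assume "e = []"
      then have "V b n = nf (\<gamma> @ V b' n) @ finv a"
        using are(1,2) by (simp add: finv_eq_iff)
      with overlap_trivial[OF that(1) n] False show False by blast
    qed
    then have "last e = last (V b' n)"
      using are(2) last_mult[OF that(1), of b'] by simp
    then show ?thesis
      using are(3) \<open>e \<noteq> []\<close> by simp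
  next
    case True
    \<comment> \<open>The two opposite rays join at \<open>x\<close> into a straight segment of
      \<open>n + n\<close> periods.\<close>
    then have b: "(\<not> b) = b'" using that(2) by auto
    have "nf (finv (V b n) @ \<gamma> @ V b' n) = nf (wpow (cs b') (n + n))"
      using True nf_inv_left_mid[of "wpow (cs b') n" x "wpow (cs b') n"]
      by (simp add: V_def finv_wpow finv_cs b wpow_add)
    also have "\<dots> = wpow (cs b') (n + n)"
      by (intro nf_reduced reduced_wpow reduced_cs)
    finally show ?thesis
      using cs_nonempty[of b'] last_wpow[of "cs b'" "n + n"] unfolding last_V by (simp add: n)
  qed
qed

end

text \<open>Pigeonhole: if every \<open>x @ wpow c n\<close> were a prefix of a subgroup element,
  quasiconvexity would give bounded coset representatives for all of them. Two would coincide,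
  putting a positive power of \<open>x @ c @ finv x\<close> into the subgroup.\<close>

lemma axis_leaves_core:
  assumes "finite S" "S \<subseteq> FG d" "x @ c @ finv x \<in> FG d" "c \<noteq> []" "reduced (c @ c)"
    and no_power: "\<And>k. k > 0 \<Longrightarrow> nf (x @ wpow c k @ finv x) \<notin> gen_subgroup d S"
  obtains n where "\<And>r. x @ wpow c n @ r \<notin> gen_subgroup d S"
proof -
  let ?G = "gen_subgroup d S" and ?V = "\<lambda>n. x @ wpow c n"
  note G = is_subgroup_gen_subgroup[OF assms(2)]
  have "\<exists>n. \<forall>r. ?V n @ r \<notin> ?G"
  proof (rule ccontr)
    assume "\<not> ?thesis"
    then obtain r where r: "\<And>n. ?V n @ r n \<in> ?G" by metis
    obtain C where C: "\<And>p q. p @ q \<in> ?G \<Longrightarrow> \<exists>h\<in>?G. length (nf (h @ p)) \<le> C"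
      using gen_subgroup_quasiconvex[OF assms(1,2)] by blast
    have "\<forall>n. \<exists>h. h \<in> ?G \<and> length (nf (h @ ?V n)) \<le> C"
      using C[OF r] by blast
    then obtain h where h: "\<And>n. h n \<in> ?G" "\<And>n. length (nf (h n @ ?V n)) \<le> C"
      by metis
    let ?f = "\<lambda>n. nf (h n @ ?V n)"
    let ?B = "{w :: word. set w \<subseteq> {..<d} \<times> UNIV \<and> length w \<le> C}"
    have "?f n \<in> ?B" for n
    proof -
      have "set (?f n) \<subseteq> set (h n) \<union> (set x \<union> set c)"
        using set_nf_subset[of "h n @ ?V n"] set_wpow[of c n] by auto
      moreover have "\<forall>y\<in>set (h n) \<union> (set x \<union> set c). fst y < d"
        using subgroup_FG[OF G h(1)] assms(3) by (auto simp only: FG_iff set_append)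
      ultimately show ?thesis
        using h(2)[of n] by (auto simp: subset_iff Ball_def)
    qed
    then have "range ?f \<subseteq> ?B" by blast
    then have "finite (range ?f)"
      by (rule finite_subset) (intro finite_lists_length_le, simp)
    then have "\<not> inj ?f"
      using finite_imageD infinite_UNIV_nat by blast
    then obtain i j where "i < j" "?f i = ?f j"
      unfolding inj_def by (metis linorder_neqE_nat)
    have "nf (finv (h j) @ h i @ ?V i) = nf (finv (h j) @ ?f i)"
      by simp
    also have "\<dots> = nf (?V j)"
      unfolding \<open>?f i = ?f j\<close> by simp
    finally have "nf (finv (h j) @ h i @ ?V i) = nf (?V j)" .
    also have "?V j = (x @ wpow c (j - i)) @ wpow c i"
      using \<open>i < j\<close> wpow_add[of c "j - i" i] by simp
    also have "nf \<dots> = nf ((x @ wpow c (j - i) @ finv x) @ ?V i)"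
      using nf_inv_left_mid[of "x @ wpow c (j - i)" x "wpow c i"] by simp
    finally have "nf ((finv (h j) @ h i) @ ?V i) = nf ((x @ wpow c (j - i) @ finv x) @ ?V i)"
      by simp
    then have "nf (finv (h j) @ h i) = nf (x @ wpow c (j - i) @ finv x)"
      by (rule nf_cancel_right)
    moreover have "nf (finv (h j) @ h i) \<in> ?G"
      by (intro subgroup_mult[OF G] subgroup_finv[OF G] h)
    ultimately show False
      using no_power[of "j - i"] \<open>i < j\<close> by simp
  qed
  with that show ?thesis by auto
qed

text \<open>If no power of \<open>g\<close> is present yet, both axis ends leave the core. The
  constant \<open>Q\<close> is then fixed before the exponent, so a long middle syllable pushes the
  new terms below any \<open>\<eta>\<close>, however large \<open>p\<close> is.\<close>

lemma adjoin_large_power: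
  assumes S: "finite S" "S \<subseteq> FG d" and "wbound s (gen_subgroup d S) p" "s > 0"
    and "g \<in> FG d" "\<eta> > 0"
  shows "\<exists>S' k. finite S' \<and> S \<subseteq> S' \<and> S' \<subseteq> FG d \<and> k > 0 \<and> nf (wpow g k) \<in> gen_subgroup d S' \<and>
    wbound s (gen_subgroup d S' - gen_subgroup d S) \<eta>"
proof (cases "\<exists>k>0. nf (wpow g k) \<in> gen_subgroup d S")
  case True
  have "wbound s (gen_subgroup d S - gen_subgroup d S) \<eta>"
    using \<open>\<eta> > 0\<close> by (auto intro: wboundI)
  with True S show ?thesis by blast
next
  case False
  let ?G = "gen_subgroup d S"
  note G = is_subgroup_gen_subgroup[OF S(2)]
  have "nf (wpow g 1) = g"
    using assms(5) by (simp add: wpow_Suc FG_iff nf_reduced)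
  with False subgroup_Nil[OF G] have "g \<noteq> []"
    by (metis zero_less_one)
  then obtain x c where g: "g = x @ c @ finv x" and c: "c \<noteq> []" "reduced (c @ c)"
    using cyclic_reduction[of g] assms(5) by (auto simp: FG_iff)
  have red: "reduced (x @ c @ finv x)"
    using assms(5) by (simp add: g FG_iff)
  have no_power: "nf (x @ wpow c k @ finv x) \<notin> ?G" if "k > 0" for k
    unfolding nf_wpow_conj[symmetric] g[symmetric] using False that by blast
  have no_power': "nf (x @ wpow (finv c) k @ finv x) \<notin> ?G" if "k > 0" for k
  proof
    assume "nf (x @ wpow (finv c) k @ finv x) \<in> ?G"
    then have "finv (nf (x @ wpow (finv c) k @ finv x)) \<in> ?G"
      by (rule subgroup_finv[OF G])
    then show False
      using no_power[OF that] by (simp add: finv_wpow flip: nf_finv)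
  qed
  obtain n1 where n1: "\<And>r. x @ wpow c n1 @ r \<notin> ?G"
    using axis_leaves_core[OF S _ c no_power] assms(5) by (auto simp: g)
  have "x @ finv c @ finv x \<in> FG d"
    using FG_finv[OF assms(5)] by (simp add: g)
  moreover have "reduced (finv c @ finv c)"
    using c(2) reduced_finv[of "c @ c"] by simp
  ultimately obtain n2 where n2: "\<And>r. x @ wpow (finv c) n2 @ r \<notin> ?G"
    using axis_leaves_core[OF S _ _ _ no_power'] c(1) by auto
  \<comment> \<open>A common threshold for both directions: a ray that is not a prefix of any
    subgroup element stays so when prolonged.\<close>
  define n0 where "n0 = n1 + n2"
  define cs where "cs = (\<lambda>b. if b then c else finv c)"
  define V where "V = (\<lambda>b n. x @ wpow (cs b) n)"
  have leaves: "x @ wpow (if b then c else finv c) n0 @ r \<notin> ?G" for b r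
    using n1 n2 wpow_add[of c n1 n2] wpow_add[of "finv c" n2 n1]
    by (auto simp: n0_def add.commute)
  interpret axis d ?G x c n0 cs V
    by unfold_locales (use G red c leaves in \<open>auto simp: cs_def V_def\<close>)
  define n where "n = n0 + Suc (length x)"
  define K where "K = length x + n * length c"
  define Q where "Q = exp (2 * s * real K) * p"
  define \<theta> where "\<theta> = (\<lambda>l. 2 * exp (- s * real l) * Q)"
  have "(\<lambda>l. exp (- s) ^ l) \<longlonglongrightarrow> 0"
    using \<open>s > 0\<close> by (intro LIMSEQ_power_zero) simp
  then have lim: "(\<lambda>l. exp (- s * real l)) \<longlonglongrightarrow> 0"
    by (simp add: mult.commute flip: exp_of_nat_mult)
  have "\<theta> \<longlonglongrightarrow> 2 * 0 * Q" and "(\<lambda>l. 2 * \<theta> l * Q) \<longlonglongrightarrow> 2 * (2 * 0 * Q) * Q"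
    unfolding \<theta>_def by (intro tendsto_intros lim)+
  from order_tendstoD(2)[OF this(1), of "1 / 2"] order_tendstoD(2)[OF this(2), of \<eta>]
  have "\<forall>\<^sub>F l in sequentially. \<theta> l < 1 / 2 \<and> 2 * \<theta> l * Q < \<eta>"
    using \<open>\<eta> > 0\<close> by (intro eventually_conj) simp_all
  then obtain M0 where M0: "\<And>l. l \<ge> M0 \<Longrightarrow> \<theta> l < 1 / 2 \<and> 2 * \<theta> l * Q < \<eta>"
    by (auto simp: eventually_sequentially)
  \<comment> \<open>The successor keeps the middle syllable nonempty.\<close>
  define M where "M = Suc M0"
  have "M * 1 \<le> M * length c"
    using c(1) by (intro mult_le_mono) (auto simp: Suc_le_eq)
  then have M: "\<theta> (M * length c) < 1 / 2 \<and> 2 * \<theta> (M * length c) * Q < \<eta>"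
    by (intro M0) (simp add: M_def)
  interpret adjoin d ?G "\<lambda>b. V b n" "\<lambda>b. wpow (cs b) M"
    by (rule adjoin_axis) (simp_all add: n_def M_def)
  have t: "t True = x @ wpow c (n + M + n) @ finv x"
    unfolding t_def by (simp add: V_def cs_def wpow_add finv_wpow)
  have pos: "n + M + n > 0" by (simp add: M_def)
  then have "reduced (t True)"
    unfolding t by (rule reduced_conj_wpow(2)[OF red c])
  moreover have "set (t True) \<subseteq> set g"
    using set_wpow[of c "n + M + n"] by (auto simp: t g set_finv)
  ultimately have tFG: "t True \<in> FG d"
    using assms(5) unfolding FG_iff by blast
  have "wbound s (gen_subgroup d (insert (t True) S) - ?G) (2 * \<theta> (M * length c) * Q)"
    using M by (intro wbound_adjoin[OF S(2) refl tFG assms(3,4), of K "M * length c"])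
      (auto simp: length_V K_def Q_def \<theta>_def)
  then have "wbound s (gen_subgroup d (insert (t True) S) - ?G) \<eta>"
    by (rule wbound_mono) (use M in auto)
  moreover have "nf (wpow g (n + M + n)) = t True"
    using \<open>reduced (t True)\<close> unfolding g nf_wpow_conj t by (rule nf_reduced)
  then have "nf (wpow g (n + M + n)) \<in> gen_subgroup d (insert (t True) S)"
    using gen_subgroup_superset by fastforce
  ultimately show ?thesis
    using S tFG pos by (intro exI[of _ "insert (t True) S"] exI[of _ "n + M + n"]) auto
qed

section \<open>Boomerang subgroups\<close>

lemma conjg_subgroup_elem:
  assumes H: "is_subgroup d H" and "h \<in> H"
  shows "conjg h H = H"
proof -
  note red = subgroup_reduced[OF H]
  have conj: "fmul (fmul h y) (finv h) = nf (h @ y @ finv h)" if "y \<in> H" for y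
    using that assms(2) red by (simp add: fmul_nf)
  have "nf (h @ y @ finv h) \<in> H" if "y \<in> H" for y
    using subgroup_mult[OF H assms(2) subgroup_mult[OF H that subgroup_finv[OF H assms(2)]]]
    by simp
  moreover have "\<exists>z\<in>H. y = nf (h @ z @ finv h)" if "y \<in> H" for y
  proof
    show "nf (finv h @ y @ h) \<in> H"
      using subgroup_mult[OF H subgroup_finv[OF H assms(2)] subgroup_mult[OF H that assms(2)]]
      by simp
    have "nf (h @ nf (finv h @ y @ h) @ finv h) = nf (nf (h @ finv h @ y @ h) @ finv h)"
      by (simp only: nf_append_nf_append nf_nf_append append.assoc)
    also have "\<dots> = nf y"
      by (simp only: nf_inv_right) simp
    finally show "y = nf (h @ nf (finv h @ y @ h) @ finv h)"
      using red[OF that] by (simp add: nf_reduced)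
  qed
  ultimately show ?thesis
    unfolding conjg_def using conj by (auto simp: image_def)
qed

text \<open>Along the multiples of \<open>k\<close> the conjugating powers lie in
  \<open>\<Delta>\<close>, so the sequence of conjugates is constant.\<close>

lemma boomerang_if_powers:
  assumes "is_subgroup d \<Delta>" and "\<And>g. g \<in> FG d \<Longrightarrow> \<exists>k>0. nf (wpow g k) \<in> \<Delta>"
  shows "boomerang d \<Delta>"
  unfolding boomerang_def
proof (intro conjI ballI)
  fix g assume g: "g \<in> FG d"
  then obtain k where k: "k > 0" "nf (wpow g k) \<in> \<Delta>"
    using assms(2) by blast
  have "fpow g (j * k) \<in> \<Delta>" for j
  proof -
    have "wpow g (j * k) = wpow (wpow g k) j"
      by (induction j) (simp_all add: wpow_add wpow_Suc)
    then have "fpow g (j * k) = nf (wpow (wpow g k) j)"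
      using g by (simp add: fpow_eq_nf_wpow FG_iff)
    then show ?thesis
      using subgroup_wpow[OF assms(1) k(2)] by simp
  qed
  then have "(\<lambda>j. chab (conjg (fpow g (j * k)) \<Delta>)) \<longlonglongrightarrow> chab \<Delta>"
    by (simp add: conjg_subgroup_elem[OF assms(1)])
  moreover have "filterlim (\<lambda>j. j * k) at_top sequentially"
    by (rule filterlim_at_top_mono[OF filterlim_ident]) (use k(1) in auto)
  ultimately show "\<exists>n :: nat \<Rightarrow> nat. filterlim n at_top sequentially \<and>
      ((\<lambda>j. chab (conjg (fpow g (n j)) \<Delta>)) \<longlonglongrightarrow> chab \<Delta>)"
    by blast
qed (rule assms(1))

text \<open>A basic open set of the product topology constrains finitely many coordinates;
  \<open>R\<close> bounds the lengths of these words.\<close>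

lemma chab_nbhd_contains_ball:
  assumes "chab_nbhd d Nb \<Gamma>"
  obtains R where "\<And>H. is_subgroup d H \<Longrightarrow> (\<And>w. length w \<le> R \<Longrightarrow> w \<in> H \<longleftrightarrow> w \<in> \<Gamma>) \<Longrightarrow> H \<in> Nb"
proof -
  obtain X where X: "open X" "chab \<Gamma> \<in> X"
    "\<And>H. is_subgroup d H \<Longrightarrow> chab H \<in> X \<Longrightarrow> H \<in> Nb"
    using assms unfolding chab_nbhd_def by blast
  have "openin (product_topology (\<lambda>_. euclidean) UNIV) X"
    using X(1) by (simp add: open_fun_def)
  from product_topology_open_contains_basis[OF this X(2)]
  obtain Y where Y: "chab \<Gamma> \<in> (\<Pi>\<^sub>E i\<in>UNIV. Y i)" "finite {i. Y i \<noteq> UNIV}"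
    "(\<Pi>\<^sub>E i\<in>UNIV. Y i) \<subseteq> X"
    by auto
  define R where "R = Max (insert 0 (length ` {i. Y i \<noteq> UNIV}))"
  show ?thesis
  proof
    fix H assume H: "is_subgroup d H" "\<And>w. length w \<le> R \<Longrightarrow> w \<in> H \<longleftrightarrow> w \<in> \<Gamma>"
    have "chab H w \<in> Y w" for w
    proof (cases "Y w = UNIV")
      case False
      then have "length w \<le> R"
        unfolding R_def using Y(2) by (intro Max_ge) auto
      then have "chab H w = chab \<Gamma> w"
        using H(2) by (simp add: chab_def)
      then show ?thesis
        using Y(1) by (simp add: PiE_iff)
    qed simp
    then have "chab H \<in> X"
      using Y(3) by (auto simp: PiE_iff)
    then show "H \<in> Nb"
      by (rule X(3)[OF H(1)])
  qed
qed

section \<open>Critical exponents as infima\<close>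

lemma crit_exp_set_nonempty:
  assumes "H \<subseteq> FG d"
  shows "{s. s > 0 \<and> (\<lambda>\<gamma>. exp (- s * real (wlen \<gamma>))) summable_on H} \<noteq> {}"
proof -
  obtain s b where "s > 0" "wbound s (FG d) b"
    by (rule FG_wbound_exists)
  then have "s > 0" "wbound s H b"
    using assms by (auto intro: wbound_mono)
  then show ?thesis
    using wbound_imp_summable_on by blast
qed

text \<open>A larger set admits fewer exponents; comparing the infima requires that some exponent is
  admissible for \<open>H'\<close>.\<close>

lemma crit_exp_mono:
  assumes "H \<subseteq> H'" "H' \<subseteq> FG d"
  shows "crit_exp H \<le> crit_exp H'"
  unfolding crit_exp_def
proof (rule cInf_superset_mono[OF crit_exp_set_nonempty[OF assms(2)]])
  show "bdd_below {s. s > 0 \<and> (\<lambda>\<gamma>. exp (- s * real (wlen \<gamma>))) summable_on H}"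
    by (rule bdd_belowI[of _ 0]) auto
qed (use assms(1) in \<open>auto intro: summable_on_subset_banach\<close>)

lemma crit_exp_le:
  assumes "s > 0" "wbound s H b"
  shows "crit_exp H \<le> s"
  unfolding crit_exp_def
proof (rule cInf_lower)
  show "bdd_below {s. s > 0 \<and> (\<lambda>\<gamma>. exp (- s * real (wlen \<gamma>))) summable_on H}"
    by (rule bdd_belowI[of _ 0]) auto
qed (use assms wbound_imp_summable_on in auto)

text \<open>The series may diverge at the critical exponent itself, so an exponent below
  \<open>u\<close> is chosen where it converges.\<close>

lemma crit_exp_less_imp_wbound:
  assumes "H \<subseteq> FG d" "crit_exp H < u"
  obtains s b where "0 < s" "s < u" "wbound s H b"
proof -
  obtain s where "s > 0" "s < u" "(\<lambda>\<gamma>. exp (- s * real (wlen \<gamma>))) summable_on H"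
    using cInf_lessD[OF crit_exp_set_nonempty[OF assms(1)] assms(2)[unfolded crit_exp_def]] by auto
  then show ?thesis
    using summable_on_imp_wbound that by blast
qed

section \<open>The ascending union\<close>

lemma is_subgroup_Union_chain:
  assumes "\<And>n. is_subgroup d (H n)" "mono (H :: nat \<Rightarrow> word set)"
  shows "is_subgroup d (\<Union>n. H n)"
  unfolding is_subgroup_iff
proof (intro conjI ballI)
  show "(\<Union>n. H n) \<subseteq> FG d"
    using subgroup_FG[OF assms(1)] by blast
  show "[] \<in> (\<Union>n. H n)"
    using subgroup_Nil[OF assms(1)] by blast
next
  fix g h assume "g \<in> (\<Union>n. H n)" "h \<in> (\<Union>n. H n)"
  then obtain m n where "g \<in> H m" "h \<in> H n" by blast
  then have "g \<in> H (max m n)" "h \<in> H (max m n)"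
    using monoD[OF assms(2), of m "max m n"] monoD[OF assms(2), of n "max m n"] by auto
  then show "nf (g @ h) \<in> (\<Union>n. H n)"
    using subgroup_mult[OF assms(1)] by blast
next
  fix g assume "g \<in> (\<Union>n. H n)"
  then show "finv g \<in> (\<Union>n. H n)"
    using subgroup_finv[OF assms(1)] by blast
qed

text \<open>Stage \<open>n\<close> treats the \<open>n\<close>-th element of the free group and may
  add at most \<open>\<eta> / 2 * (1 / 2) ^ n\<close> to the exponential sum; these allowances add
  up to at most \<open>\<eta>\<close>.\<close>

lemma exists_overgroup_with_powers:
  assumes S: "finite S" "S \<subseteq> FG d" and "wbound s (gen_subgroup d S) p" "s > 0" "\<eta> > 0"
  obtains \<Delta> where "is_subgroup d \<Delta>" "gen_subgroup d S \<subseteq> \<Delta>"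
    "\<And>g. g \<in> FG d \<Longrightarrow> \<exists>k>0. nf (wpow g k) \<in> \<Delta>"
    "wbound s (\<Delta> - gen_subgroup d S) \<eta>"
proof -
  let ?G = "gen_subgroup d"
  define e where "e n = (if from_nat n \<in> FG d then from_nat n else [] :: word)" for n
  have e_FG: "e n \<in> FG d" for n
    by (simp add: e_def FG_iff)
  \<comment> \<open>The clause for \<open>n = 0\<close> pins the start to \<open>S\<close>, because
    dependent choice only promises some initial set. The bound \<open>p\<close> may change with the
    stage.\<close>
  define P where "P n X \<longleftrightarrow> finite X \<and> X \<subseteq> FG d \<and> (\<exists>p. wbound s (?G X) p) \<and> (n = 0 \<longrightarrow> X = S)"
    for n :: nat and X
  define Q where "Q n X Y \<longleftrightarrow> X \<subseteq> Y \<and> (\<exists>k>0. nf (wpow (e n) k) \<in> ?G Y) \<and>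
    wbound s (?G Y - ?G X) (\<eta> / 2 * (1 / 2) ^ n)" for n X Y
  have "\<exists>f. \<forall>n. P n (f n) \<and> Q n (f n) (f (Suc n))"
  proof (rule dependent_nat_choice)
    show "\<exists>X. P 0 X"
      using assms(3) S by (auto simp: P_def)
  next
    fix X n assume "P n X"
    then obtain q where X: "finite X" "X \<subseteq> FG d" "wbound s (?G X) q"
      by (auto simp: P_def)
    have "\<eta> / 2 * (1 / 2) ^ n > 0"
      using \<open>\<eta> > 0\<close> by simp
    from adjoin_large_power[OF X \<open>s > 0\<close> e_FG this]
    obtain Y k where Y: "finite Y" "X \<subseteq> Y" "Y \<subseteq> FG d" "k > 0" "nf (wpow (e n) k) \<in> ?G Y"
      "wbound s (?G Y - ?G X) (\<eta> / 2 * (1 / 2) ^ n)"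
      by blast
    have "wbound s (?G Y) (q + \<eta> / 2 * (1 / 2) ^ n)"
      by (rule wbound_mono[OF wbound_Un[OF X(3) Y(6)]]) auto
    with Y show "\<exists>Y. P (Suc n) Y \<and> Q n X Y"
      unfolding P_def Q_def by blast
  qed
  then obtain f where "\<And>n. P n (f n)" and Q: "\<And>n. Q n (f n) (f (Suc n))"
    by blast
  then have f: "f n \<subseteq> FG d" "f 0 = S" for n
    by (auto simp: P_def)
  define \<Delta> where "\<Delta> = (\<Union>n. ?G (f n))"
  have "mono (\<lambda>n. ?G (f n))"
    by (rule incseq_SucI) (use Q in \<open>auto simp: Q_def intro!: gen_subgroup_mono\<close>)
  then have "is_subgroup d \<Delta>"
    unfolding \<Delta>_def by (intro is_subgroup_Union_chain is_subgroup_gen_subgroup f)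
  moreover have "?G S \<subseteq> \<Delta>"
    unfolding \<Delta>_def f(2)[symmetric] by blast
  moreover have "\<exists>k>0. nf (wpow g k) \<in> \<Delta>" if "g \<in> FG d" for g
  proof -
    have "e (to_nat g) = g"
      using that by (simp add: e_def)
    then show ?thesis
      using Q[of "to_nat g"] by (auto simp: Q_def \<Delta>_def)
  qed
  moreover have "wbound s (\<Delta> - ?G S) \<eta>"
  proof -
    \<comment> \<open>An element that is in a later stage but not in the first is new at some stage
      in between.\<close>
    have "w \<in> ?G (f n) \<Longrightarrow> w \<notin> ?G (f 0) \<Longrightarrow> w \<in> (\<Union>n. ?G (f (Suc n)) - ?G (f n))" for w n
      by (induction n) auto
    then have sub: "\<Delta> - ?G S \<subseteq> (\<Union>n. ?G (f (Suc n)) - ?G (f n))"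
      unfolding \<Delta>_def f(2)[symmetric] by blast
    have "wbound s (\<Union>n. ?G (f (Suc n)) - ?G (f n)) \<eta>"
    proof (rule wbound_UN)
      show "wbound s (?G (f (Suc n)) - ?G (f n)) (\<eta> / 2 * (1 / 2) ^ n)" for n
        using Q by (simp add: Q_def)
      have "(\<Sum>n<m. \<eta> / 2 * (1 / 2) ^ n) = \<eta> / 2 * (\<Sum>n<m. (1 / 2) ^ n)" for m
        by (rule sum_distrib_left[symmetric])
      also have "\<eta> / 2 * (\<Sum>n<m. (1 / 2) ^ n) \<le> \<eta> / 2 * 2" for m
        using \<open>\<eta> > 0\<close> by (intro mult_left_mono geometric_partial_sum_le) auto
      finally show "(\<Sum>n<m. \<eta> / 2 * (1 / 2) ^ n) \<le> \<eta>" for m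
        by simp
    qed
    then show ?thesis
      by (rule wbound_mono[OF _ sub]) simp
  qed
  ultimately show ?thesis
    using that by blast
qed

theorem theorem1p2:
  fixes d :: nat and \<Gamma> :: "word set" and Nb :: "word set set" and \<epsilon> :: real
  assumes "is_subgroup d \<Gamma>" and "fin_gen d \<Gamma>"
    and "chab_nbhd d Nb \<Gamma>" and "\<epsilon> > 0"
  shows "\<exists>\<Delta>. boomerang d \<Delta> \<and> \<Delta> \<in> Nb \<and>
           crit_exp \<Gamma> \<le> crit_exp \<Delta> \<and> crit_exp \<Delta> \<le> crit_exp \<Gamma> + \<epsilon>"
proof -
  obtain S where S: "finite S" "S \<subseteq> FG d" and \<Gamma>: "\<Gamma> = gen_subgroup d S"
    using assms(2) by (auto simp: fin_gen_def)
  have "\<Gamma> \<subseteq> FG d" "crit_exp \<Gamma> < crit_exp \<Gamma> + \<epsilon>"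
    using assms(1,4) by (auto simp: is_subgroup_def)
  \<comment> \<open>The whole construction runs at this one exponent, so no loss accumulates over
    its infinitely many stages.\<close>
  then obtain s p where s: "0 < s" "s < crit_exp \<Gamma> + \<epsilon>" "wbound s \<Gamma> p"
    by (rule crit_exp_less_imp_wbound)
  obtain R where R: "\<And>H. is_subgroup d H \<Longrightarrow> (\<And>w. length w \<le> R \<Longrightarrow> w \<in> H \<longleftrightarrow> w \<in> \<Gamma>) \<Longrightarrow> H \<in> Nb"
    using chab_nbhd_contains_ball[OF assms(3)] by blast
  \<comment> \<open>Half the weight of a word of length \<open>R\<close>; halving makes the
    comparison below strict.\<close>
  define \<eta> where "\<eta> = exp (- s * real R) / 2"
  have "\<eta> > 0" by (simp add: \<eta>_def)
  from exists_overgroup_with_powers[OF S s(3)[unfolded \<Gamma>] s(1) this]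
  obtain \<Delta> where \<Delta>: "is_subgroup d \<Delta>" "\<Gamma> \<subseteq> \<Delta>" "\<And>g. g \<in> FG d \<Longrightarrow> \<exists>k>0. nf (wpow g k) \<in> \<Delta>"
    "wbound s (\<Delta> - \<Gamma>) \<eta>"
    unfolding \<Gamma> by blast
  \<comment> \<open>A new element of length at most \<open>R\<close> would on its own contribute more than \<open>\<eta>\<close>.\<close>
  have "w \<in> \<Gamma>" if "length w \<le> R" "w \<in> \<Delta>" for w
  proof (rule ccontr)
    assume "w \<notin> \<Gamma>"
    with that(2) have "exp (- s * real (length w)) \<le> \<eta>"
      by (intro wbound_elem[OF \<Delta>(4)]) simp
    moreover have "exp (- s * real R) \<le> exp (- s * real (length w))"
      using that(1) s(1) by simp
    ultimately have "exp (- s * real R) \<le> \<eta>" by linarith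
    then show False by (simp add: \<eta>_def)
  qed
  then have "\<Delta> \<in> Nb"
    using \<Delta>(1,2) by (intro R) auto
  moreover have "crit_exp \<Gamma> \<le> crit_exp \<Delta>"
    using \<Delta>(1,2) by (intro crit_exp_mono[of _ _ d]) (auto simp: is_subgroup_def)
  moreover have "wbound s \<Delta> (p + \<eta>)"
    by (rule wbound_mono[OF wbound_Un[OF s(3) \<Delta>(4)]]) auto
  then have "crit_exp \<Delta> \<le> s"
    by (rule crit_exp_le[OF s(1)])
  ultimately show ?thesis
    using boomerang_if_powers[OF \<Delta>(1,3)] s(2) by fastforce
qed

end
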